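(* Let $\ell:[0,\infty)\to(0,\infty)$ be non-decreasing, positive and locally Lipschitz. Then for all $\Delta\ge0$ and $M_0\ge0$ there is a finite number $\bar T(\ell,\Delta,M_0)\ge0$, depending only on $\ell$, $\Delta$ and $M_0$, such that the following holds. Let $f:\mathbb{R}^d\to\mathbb{R}\cup\{\infty\}$ be $\ell$-smooth and convex, attaining its minimum at $x_*\in\mathbb{R}^d$, let $x_0\in\mathcal{X}$ with $f(x_0)-f(x_* )=\Delta$ and $\|\nabla f(x_0)\|=M_0$, put $R:=\|x_0-x_*\|$, and let $\{x_k\}_{k\ge0}$ be generated by $$x_{k+1}=x_k-\gamma_k\nabla f(x_k),\qquad \gamma_k=\int_0^1\frac{dv}{\ell(\|\nabla f(x_k)\|+\|\nabla f(x_k)\|v)}.$$ Then for every $\varepsilon>0$ and every integer $T\ge0$ with $$T\ge\frac{\ell(0)R^2}{\varepsilon}+\min\left\{\bar T(\ell,\Delta,M_0),\frac{\ell(2M_0)R^2}{2\varepsilon}\right\}$$ one has $f(x_T)-f(x_* )\le\varepsilon$. (In particular $\bar T(\ell,\Delta,M_0)$ does not depend on $\varepsilon$.)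
   Context: Norms are Euclidean for vectors and spectral for matrices. For $f:\mathbb{R}^d\to\mathbb{R}\cup\{\infty\}$ put $\mathcal{X}=\{x\in\mathbb{R}^d: f(x)<\infty\}$, assumed to be open and convex. $f$ is $\ell$-smooth if $f$ is twice differentiable on $\mathcal{X}$, $f$ is continuous on the closure of $\mathcal{X}$ (as a map into $\mathbb{R}\cup\{\infty\}$), and $\|\nabla^2f(x)\|\le\ell(\|\nabla f(x)\|)$ for all $x\in\mathcal{X}$. (The iteration is well defined: the iterates stay in $\mathcal{X}$.) *)

theory Defs
  imports "HOL-Analysis.Analysis" "HOL-Library.Poly_Mapping"
begin

text \<open>
  The dimension \<open>d\<close> has to be an ordinary natural number here, because a constant is claimed
  to be independent of it.  We therefore realise \<open>\<real>\<^sup>d\<close> as the subspace of those finitely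
  supported real sequences that vanish from index \<open>d\<close> on.  Finitely supported families
  carry the Euclidean inner product, so that the library notions of norm, topology, Frechet
  derivative and convexity apply, always taken relative to \<open>\<real>\<^sup>d\<close>.
\<close>

instantiation poly_mapping :: (type, real_vector) real_vector
begin

lift_definition scaleR_poly_mapping :: "real \<Rightarrow> ('a \<Rightarrow>\<^sub>0 'b) \<Rightarrow> ('a \<Rightarrow>\<^sub>0 'b)"
  is "\<lambda>r x i. r *\<^sub>R x i"
  by (rule finite_subset) auto

instance
  by standard (transfer; simp add: fun_eq_iff scaleR_add_left scaleR_add_right)+

end

instantiation poly_mapping :: (type, real_inner) real_inner
begin

definition inner_poly_mapping_def:
  "inner x y =
    (\<Sum>i\<in>Poly_Mapping.keys x. inner (Poly_Mapping.lookup x i) (Poly_Mapping.lookup y i))"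

definition norm_poly_mapping_def:
  "norm (x :: 'a \<Rightarrow>\<^sub>0 'b) = sqrt (inner x x)"

definition dist_poly_mapping_def:
  "dist (x :: 'a \<Rightarrow>\<^sub>0 'b) y = norm (x - y)"

definition sgn_poly_mapping_def:
  "sgn (x :: 'a \<Rightarrow>\<^sub>0 'b) = x /\<^sub>R norm x"

definition uniformity_poly_mapping_def:
  "(uniformity :: (('a \<Rightarrow>\<^sub>0 'b) \<times> ('a \<Rightarrow>\<^sub>0 'b)) filter) =
     (INF e\<in>{0<..}. principal {(x :: 'a \<Rightarrow>\<^sub>0 'b, y). dist x y < e})"

definition open_poly_mapping_def:
  "open (U :: ('a \<Rightarrow>\<^sub>0 'b) set) \<longleftrightarrow>
    (\<forall>x\<in>U. eventually (\<lambda>(x', y). x' = x \<longrightarrow> y \<in> U) uniformity)"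

lemma inner_poly_mapping_superset:
  assumes "finite A" "Poly_Mapping.keys x \<subseteq> A"
  shows "inner x y = (\<Sum>i\<in>A. inner (Poly_Mapping.lookup x i) (Poly_Mapping.lookup y i))"
  unfolding inner_poly_mapping_def
  by (rule sum.mono_neutral_left) (use assms in \<open>auto simp: in_keys_iff\<close>)

instance
proof
  fix x y z :: "'a \<Rightarrow>\<^sub>0 'b" and r :: real
  let ?A = "Poly_Mapping.keys x \<union> Poly_Mapping.keys y \<union> Poly_Mapping.keys z"
  have lookup_scaleR: "Poly_Mapping.lookup (r *\<^sub>R x) i = r *\<^sub>R Poly_Mapping.lookup x i" for i
    by transfer simp
  show "dist x y = norm (x - y)" by (rule dist_poly_mapping_def)
  show "sgn x = x /\<^sub>R norm x" by (rule sgn_poly_mapping_def)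
  show "(uniformity :: (('a \<Rightarrow>\<^sub>0 'b) \<times> ('a \<Rightarrow>\<^sub>0 'b)) filter)
          = (INF e\<in>{0<..}. principal {(x, y). dist x y < e})"
    by (rule uniformity_poly_mapping_def)
  show "open U \<longleftrightarrow> (\<forall>x\<in>U. eventually (\<lambda>(x', y). x' = x \<longrightarrow> y \<in> U) uniformity)"
    for U :: "('a \<Rightarrow>\<^sub>0 'b) set"
    by (rule open_poly_mapping_def)
  show "norm x = sqrt (inner x x)" by (rule norm_poly_mapping_def)
  show "inner x y = inner y x"
    by (simp add: inner_poly_mapping_superset[where A = ?A] inner_commute subset_iff)
  show "inner (x + y) z = inner x z + inner y z"
    using Poly_Mapping.keys_add[of x y]
    by (simp add: inner_poly_mapping_superset[where A = ?A] subset_iff lookup_add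
        inner_add_left sum.distrib)
  have "Poly_Mapping.keys (r *\<^sub>R x) \<subseteq> Poly_Mapping.keys x"
    by (auto simp: in_keys_iff lookup_scaleR)
  then show "inner (r *\<^sub>R x) y = r * inner x y"
    by (simp add: inner_poly_mapping_superset[where A = "Poly_Mapping.keys x"] lookup_scaleR
        sum_distrib_left)
  show "0 \<le> inner x x"
    by (simp add: inner_poly_mapping_def sum_nonneg)
  show "inner x x = 0 \<longleftrightarrow> x = 0"
    by (auto simp: inner_poly_mapping_def sum_nonneg_eq_0_iff in_keys_iff
        intro!: poly_mapping_eqI)
qed

end

type_synonym fseq = "nat \<Rightarrow>\<^sub>0 real"

definition Rn :: "nat \<Rightarrow> fseq set"
  where "Rn d = {x. \<forall>i\<ge>d. Poly_Mapping.lookup x i = 0}"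

lemma inner_Rn:
  assumes "x \<in> Rn d"
  shows "inner x y = (\<Sum>i<d. Poly_Mapping.lookup x i * Poly_Mapping.lookup y i)"
  using assms inner_poly_mapping_superset[of "{..<d}" x y]
  by (force simp: Rn_def in_keys_iff not_less[symmetric])

lemma subspace_Rn: "subspace (Rn d)"
proof -
  have "Poly_Mapping.lookup (r *\<^sub>R x) i = r * Poly_Mapping.lookup x i" for r and x :: fseq and i
    by transfer simp
  then show ?thesis
    by (auto simp: subspace_def Rn_def lookup_add)
qed

lemma norm_Rn: "x \<in> Rn d \<Longrightarrow> norm x = L2_set (Poly_Mapping.lookup x) {..<d}"
  by (simp add: norm_eq_sqrt_inner inner_Rn L2_set_def power2_eq_square)

definition effective_domain :: "nat \<Rightarrow> (fseq \<Rightarrow> ereal) \<Rightarrow> fseq set"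
  where "effective_domain d f = {x \<in> Rn d. f x < \<infinity>}"

text \<open>
  The derivatives are meaningful at points of the (relatively open) effective domain, near
  which \<open>f\<close> is finite and \<open>real_of_ereal (f y)\<close> is its value.
\<close>

definition has_gradient :: "nat \<Rightarrow> (fseq \<Rightarrow> ereal) \<Rightarrow> fseq \<Rightarrow> fseq \<Rightarrow> bool"
  where "has_gradient d f g x \<longleftrightarrow>
    g \<in> Rn d \<and> ((\<lambda>y. real_of_ereal (f y)) has_derivative (\<lambda>h. inner g h)) (at x within Rn d)"

definition gradient :: "nat \<Rightarrow> (fseq \<Rightarrow> ereal) \<Rightarrow> fseq \<Rightarrow> fseq"
  where "gradient d f x = (THE g. has_gradient d f g x)"

lemma has_derivative_within_Rn_unique:
  fixes F :: "fseq \<Rightarrow> 'b::real_normed_vector"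
  assumes A: "(F has_derivative A) (at x within Rn d)"
    and B: "(F has_derivative B) (at x within Rn d)"
    and x: "x \<in> Rn d" and v: "v \<in> Rn d"
  shows "A v = B v"
proof -
  define p where "p = (\<lambda>t. x + t *\<^sub>R v)"
  have p: "(p has_derivative (\<lambda>t. t *\<^sub>R v)) (at 0)"
    unfolding p_def by (auto intro!: derivative_eq_intros)
  have sub: "range p \<subseteq> Rn d"
    using subspace_add[OF subspace_Rn x] subspace_scale[OF subspace_Rn v] by (auto simp: p_def)
  have "((\<lambda>t. F (p t)) has_derivative (\<lambda>t. C (t *\<^sub>R v))) (at 0)"
    if "(F has_derivative C) (at x within Rn d)" for C
    using has_derivative_in_compose[OF p] has_derivative_subset[OF that sub]
    by (simp add: p_def)
  from this[OF A] this[OF B] have "(\<lambda>t. A (t *\<^sub>R v)) = (\<lambda>t. B (t *\<^sub>R v))"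
    by (rule has_derivative_unique)
  from fun_cong[OF this, of 1] show ?thesis by simp
qed

lemma gradient_eqI:
  assumes "has_gradient d f g x" "x \<in> Rn d"
  shows "gradient d f x = g"
  unfolding gradient_def
proof (rule the_equality)
  fix g' assume g': "has_gradient d f g' x"
  then have "g' - g \<in> Rn d"
    using assms by (auto simp: has_gradient_def intro: subspace_diff[OF subspace_Rn])
  then have "inner g' (g' - g) = inner g (g' - g)"
    using assms g' unfolding has_gradient_def
    by (blast intro: has_derivative_within_Rn_unique)
  then have "inner (g' - g) (g' - g) = 0"
    by (simp add: inner_diff_left)
  then show "g' = g" by simp
qed (rule assms)

text \<open>
  Only the restriction of \<open>H\<close> to \<open>\<real>\<^sup>d\<close> is determined by this; nothing below depends on
  its values elsewhere.
\<close>

definition has_hessian :: "nat \<Rightarrow> (fseq \<Rightarrow> ereal) \<Rightarrow> (fseq \<Rightarrow> fseq) \<Rightarrow> fseq \<Rightarrow> bool"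
  where "has_hessian d f H x \<longleftrightarrow> (gradient d f has_derivative H) (at x within Rn d)"

definition spectral_norm :: "nat \<Rightarrow> (fseq \<Rightarrow> fseq) \<Rightarrow> real"
  where "spectral_norm d H = (SUP v\<in>{v \<in> Rn d. norm v \<le> 1}. norm (H v))"

text \<open>
  The standing assumptions on the function and its effective domain are included.
\<close>

definition ell_smooth :: "(real \<Rightarrow> real) \<Rightarrow> nat \<Rightarrow> (fseq \<Rightarrow> ereal) \<Rightarrow> bool"
  where "ell_smooth ell d f \<longleftrightarrow>
    (\<forall>x\<in>Rn d. f x \<noteq> -\<infinity>) \<and>
    openin (top_of_set (Rn d)) (effective_domain d f) \<and>
    convex (effective_domain d f) \<and>
    continuous_on (closure (effective_domain d f)) f \<and>
    (\<forall>x\<in>effective_domain d f.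
      (\<exists>g. has_gradient d f g x) \<and>
      (\<exists>H. has_hessian d f H x \<and> spectral_norm d H \<le> ell (norm (gradient d f x))))"

text \<open>
  The convention \<open>0 * \<infinity> = 0\<close> of \<open>ereal\<close> makes the endpoints \<open>u = 0\<close>, \<open>v = 0\<close> harmless.
\<close>

definition convex_fun :: "nat \<Rightarrow> (fseq \<Rightarrow> ereal) \<Rightarrow> bool"
  where "convex_fun d f \<longleftrightarrow>
    (\<forall>x\<in>Rn d. \<forall>y\<in>Rn d. \<forall>u\<ge>0. \<forall>v\<ge>0. u + v = 1 \<longrightarrow>
      f (u *\<^sub>R x + v *\<^sub>R y) \<le> ereal u * f x + ereal v * f y)"

definition is_minimizer :: "nat \<Rightarrow> (fseq \<Rightarrow> ereal) \<Rightarrow> fseq \<Rightarrow> bool"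
  where "is_minimizer d f z \<longleftrightarrow> z \<in> Rn d \<and> (\<forall>y\<in>Rn d. f z \<le> f y)"

definition step_size :: "(real \<Rightarrow> real) \<Rightarrow> real \<Rightarrow> real"
  where "step_size ell a = integral {0..1} (\<lambda>v. 1 / ell (a + a * v))"

definition gradient_descent ::
    "(real \<Rightarrow> real) \<Rightarrow> nat \<Rightarrow> (fseq \<Rightarrow> ereal) \<Rightarrow> (nat \<Rightarrow> fseq) \<Rightarrow> bool"
  where "gradient_descent ell d f x \<longleftrightarrow>
    (\<forall>k. x (Suc k) = x k - step_size ell (norm (gradient d f (x k))) *\<^sub>R gradient d f (x k))"

text \<open>
  Functions on \<open>[0,\<infinity>)\<close> are represented by functions on \<open>\<real>\<close> whose values at negative
  arguments are irrelevant.
\<close>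

definition locally_lipschitz_nonneg :: "(real \<Rightarrow> real) \<Rightarrow> bool"
  where "locally_lipschitz_nonneg ell \<longleftrightarrow>
    (\<forall>s\<ge>0. \<exists>u>0. \<exists>L. L-lipschitz_on (cball s u \<inter> {0..}) ell)"

end

theory Submission
  imports Defs
begin

text \<open>
  Write \<open>a = norm (g x)\<close>, \<open>\<gamma>\<close> for the step size at \<open>x\<close>, and \<open>x'\<close> for the next iterate.  The step
  size is an integral, so the step can be walked continuously: at time \<open>v \<in> [0,1]\<close> the point is
  \<open>x - \<kappa>(v) g(x)\<close> with \<open>\<kappa>'(v) = 1 / ell (a + a v)\<close>.  With this speed the gradient has moved by at
  most \<open>a v\<close> at time \<open>v\<close>: as long as this is so, the Hessian at that point has norm at most
  \<open>ell (a + a v)\<close>, which the speed cancels exactly (\<open>curve_displacement_bound\<close>).  Three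
  consequences carry the proof.

  \<^item> The inner product of the current gradient with \<open>g x\<close> is at least \<open>a\<^sup>2 (1 - v)\<close>, so \<open>F\<close> decreases
    along the path.  Since \<open>F\<close> is bounded there and tends to infinity at the boundary of its domain,
    the path cannot leave the domain.  Because \<open>\<kappa>\<close> is concave, integration gives
    \<open>F x' \<le> F x - \<gamma> a\<^sup>2 / 2\<close>.

  \<^item> Convexity makes the gradient cocoercive, infinitesimally
    \<open>(norm (H u))\<^sup>2 \<le> ell (norm g) * inner (H u) u\<close> (\<open>hessian_cocoercive\<close>).  Integrated along the
    path this gives \<open>(norm w)\<^sup>2 \<le> - inner w (g x)\<close> for the total change \<open>w\<close> of the gradient, and
    hence gradient norms do not increase along the iteration (\<open>step_gradient_norm_le\<close>).

  \<^item> The descent inequality and the tangent inequality at a minimizer \<open>y\<close> combine as in the classical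
    analysis of gradient descent to \<open>2 \<gamma> (F x' - F y) \<le> (norm (x - y))\<^sup>2 - (norm (x' - y))\<^sup>2\<close>.
    Summation bounds the value gap after \<open>T\<close> steps by \<open>R\<^sup>2\<close> over twice the total step size.

  It remains to bound the total step size from below.  A gradient of norm at most \<open>M\<close> makes the step
  at least \<open>1 / ell (2 M)\<close>.  With \<open>M = M0\<close> this holds for all steps and gives the alternative
  with \<open>ell (2 M0)\<close>.  Otherwise fix \<open>M > 0\<close> with \<open>ell (2 M) \<le> 2 * ell 0\<close>, which exists by continuity of
  \<open>ell\<close> at \<open>0\<close>.  Every step with a gradient larger than \<open>M\<close> lowers the value by at least
  \<open>M\<^sup>2 / (2 * ell (2 M0))\<close>, so there are at most \<open>2 * ell (2 M0) * \<Delta> / M\<^sup>2\<close> of them, and by the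
  monotonicity of gradient norms they all come first.  All later steps are at least
  \<open>1 / (2 * ell 0)\<close>.  This count is the constant \<open>Tbar\<close>; it is free of \<open>\<epsilon>\<close>, the dimension and \<open>f\<close>.
\<close>

section \<open>Comparison of curves with a scalar reference\<close>

lemma nonincreasing_of_nonpos_derivative:
  fixes f :: "real \<Rightarrow> real"
  assumes "a \<le> b"
    and "\<And>x. x \<in> {a..b} \<Longrightarrow> (f has_real_derivative f' x) (at x within {a..b})"
    and "\<And>x. x \<in> {a..b} \<Longrightarrow> f' x \<le> 0"
  shows "f b \<le> f a"
proof -
  obtain x where x: "x \<in> {a..b}" "f b - f a = f' x * (b - a)"
    using mvt_very_simple[of a b f "\<lambda>x. (*) (f' x)"] assms(1,2)
    by (auto simp: has_field_derivative_def)
  have "f' x * (b - a) \<le> 0"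
    using assms(1) assms(3)[OF x(1)] by (intro mult_nonpos_nonneg) auto
  with x(2) show ?thesis by linarith
qed

locale growth_bound =
  fixes ell :: "real \<Rightarrow> real"
  assumes ell_pos: "0 \<le> s \<Longrightarrow> 0 < ell s"
    and ell_mono: "mono_on {0..} ell"
    and ell_cont: "continuous_on {0..} ell"
begin

lemma ell_le: "0 \<le> s \<Longrightarrow> s \<le> t \<Longrightarrow> ell s \<le> ell t"
  using ell_mono by (auto simp: mono_on_def)

text \<open>
  The base point \<open>-1\<close> and the constant extension of \<open>ell\<close> to the left make this two-sided
  differentiable at every \<open>y \<ge> 0\<close>, including \<open>0\<close>.
\<close>

definition primitive :: "real \<Rightarrow> real"
  where "primitive y = integral {-1..y} (\<lambda>v. 1 / ell (max 0 v))"

lemma primitive_deriv: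
  assumes "0 \<le> y"
  shows "(primitive has_real_derivative 1 / ell y) (at y within A)"
proof -
  have c: "continuous_on {-1..y+1} (\<lambda>v. 1 / ell (max 0 v))"
  proof (intro continuous_intros)
    show "continuous_on {-1..y+1} (\<lambda>v. ell (max 0 v))"
      by (rule continuous_on_compose2[OF ell_cont]) (auto intro!: continuous_intros)
    show "\<forall>x\<in>{-1..y+1}. ell (max 0 x) \<noteq> 0"
      using ell_pos by (metis less_irrefl max.cobounded1)
  qed
  have "((\<lambda>x. integral {-1..x} (\<lambda>v. 1 / ell (max 0 v))) has_real_derivative 1 / ell (max 0 y))
      (at y within {-1..y+1})"
    by (rule integral_has_real_derivative[OF c]) (use assms in auto)
  then have "(primitive has_real_derivative 1 / ell y) (at y within {-1..y+1})"
    using assms by (simp add: primitive_def[abs_def])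
  then have "(primitive has_real_derivative 1 / ell y) (at y)"
    using assms by (simp add: at_within_interior[of y "{-1..y+1}"])
  then show ?thesis by (rule has_field_derivative_at_within)
qed

lemma primitive_strict_mono:
  assumes "0 \<le> y" "y < z"
  shows "primitive y < primitive z"
proof (rule DERIV_pos_imp_increasing[OF assms(2)])
  fix t assume "y \<le> t"
  then have "0 \<le> t" using assms(1) by linarith
  then show "\<exists>D. (primitive has_real_derivative D) (at t) \<and> 0 < D"
    using primitive_deriv[of t UNIV] ell_pos[of t] by (intro exI[of _ "1 / ell t"]) simp
qed

text \<open>
  With \<open>r v = norm (\<psi> v - \<psi> 0)\<close> the speed is at most \<open>a * ell (a + r v) / ell (a + a * v)\<close>.
  Separating variables, \<open>primitive (a + r v)\<close> grows no faster than \<open>primitive (a + a * v)\<close>, and both start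
  at \<open>primitive a\<close>.
\<close>

lemma curve_displacement_bound:
  fixes \<psi> :: "real \<Rightarrow> 'a::real_inner"
  assumes b: "0 \<le> b" and a: "norm (\<psi> 0) = a"
    and deriv: "\<And>v. v \<in> {0..b} \<Longrightarrow> (\<psi> has_vector_derivative \<psi>' v) (at v within {0..b})"
    and speed: "\<And>v. v \<in> {0..b} \<Longrightarrow> norm (\<psi>' v) \<le> ell (norm (\<psi> v)) * a / ell (a + a * v)"
  shows "norm (\<psi> b - \<psi> 0) \<le> a * b"
proof (rule ccontr)
  have a0: "0 \<le> a" using a by auto
  let ?r = "\<lambda>v. norm (\<psi> v - \<psi> 0)"
  \<comment> \<open>\<open>r\<close> need not be differentiable where it vanishes, so it is replaced by
    \<open>sqrt (r\<^sup>2 + \<eta>\<^sup>2)\<close>, and \<open>\<eta>\<close> tends to \<open>0\<close> at the end.\<close>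
  have smoothed: "primitive (a + ?r b) \<le> primitive (a + a * b) - primitive a + primitive (a + \<eta>)"
    if \<eta>: "0 < \<eta>" for \<eta>
  proof -
    define \<rho> where "\<rho> v = sqrt (inner (\<psi> v - \<psi> 0) (\<psi> v - \<psi> 0) + \<eta>\<^sup>2)" for v
    have \<rho>_pos: "0 < \<rho> v" for v
      using \<eta> unfolding \<rho>_def by (intro real_sqrt_gt_zero add_nonneg_pos) auto
    have r_le: "?r v \<le> \<rho> v" for v
      unfolding \<rho>_def norm_eq_sqrt_inner by (intro real_sqrt_le_mono) auto
    define \<rho>' where "\<rho>' v = inner (\<psi> v - \<psi> 0) (\<psi>' v) / \<rho> v" for v
    have \<rho>_deriv: "(\<rho> has_real_derivative \<rho>' v) (at v within {0..b})" if v: "v \<in> {0..b}" for v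
    proof -
      have *: "((\<lambda>v. inner (\<psi> v - \<psi> 0) (\<psi> v - \<psi> 0) + \<eta>\<^sup>2) has_real_derivative
             2 * inner (\<psi> v - \<psi> 0) (\<psi>' v)) (at v within {0..b})"
        using deriv[OF v] unfolding has_vector_derivative_def has_field_derivative_def
        by (auto intro!: derivative_eq_intros simp: fun_eq_iff inner_commute)
      have pos: "0 < inner (\<psi> v - \<psi> 0) (\<psi> v - \<psi> 0) + \<eta>\<^sup>2"
        using \<eta> by (intro add_nonneg_pos) auto
      show ?thesis
        unfolding \<rho>_def[abs_def] \<rho>'_def
        using DERIV_chain2[OF DERIV_real_sqrt[OF pos] *]
        by (simp add: \<rho>_def field_simps)
    qed
    have "primitive (a + \<rho> b) - primitive (a + a * b) \<le> primitive (a + \<rho> 0) - primitive (a + a * 0)"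
    proof (rule nonincreasing_of_nonpos_derivative[OF b,
          where f' = "\<lambda>v. 1 / ell (a + \<rho> v) * \<rho>' v - 1 / ell (a + a * v) * a"])
      fix v assume v: "v \<in> {0..b}"
      have nn: "0 \<le> a + \<rho> v" "0 \<le> a + a * v"
        using a0 v \<rho>_pos[of v] by auto
      have "((\<lambda>v. a + \<rho> v) has_real_derivative \<rho>' v) (at v within {0..b})"
        using DERIV_add[OF DERIV_const \<rho>_deriv[OF v]] by simp
      from DERIV_chain2[where f = primitive, OF primitive_deriv[OF nn(1)] this]
      have "((\<lambda>v. primitive (a + \<rho> v)) has_real_derivative 1 / ell (a + \<rho> v) * \<rho>' v)
          (at v within {0..b})" .
      moreover have "((\<lambda>v. a + a * v) has_real_derivative a) (at v within {0..b})"
        by (auto intro!: derivative_eq_intros)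
      from DERIV_chain2[where f = primitive, OF primitive_deriv[OF nn(2)] this]
      have "((\<lambda>v. primitive (a + a * v)) has_real_derivative 1 / ell (a + a * v) * a)
          (at v within {0..b})" .
      ultimately show "((\<lambda>v. primitive (a + \<rho> v) - primitive (a + a * v)) has_real_derivative
          1 / ell (a + \<rho> v) * \<rho>' v - 1 / ell (a + a * v) * a) (at v within {0..b})"
        by (rule DERIV_diff)
      have "\<rho>' v \<le> norm (\<psi>' v)"
      proof -
        have "inner (\<psi> v - \<psi> 0) (\<psi>' v) \<le> ?r v * norm (\<psi>' v)"
          by (rule norm_cauchy_schwarz)
        also have "\<dots> \<le> \<rho> v * norm (\<psi>' v)"
          using r_le by (intro mult_right_mono) auto
        finally show ?thesis
          using \<rho>_pos[of v] by (simp add: \<rho>'_def field_simps)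
      qed
      also have "\<dots> \<le> ell (norm (\<psi> v)) * a / ell (a + a * v)"
        by (rule speed[OF v])
      also have "\<dots> \<le> ell (a + \<rho> v) * a / ell (a + a * v)"
      proof -
        have "norm (\<psi> v) \<le> a + \<rho> v"
          using norm_triangle_sub[of "\<psi> v" "\<psi> 0"] r_le[of v] a by linarith
        then show ?thesis
          using ell_le[of "norm (\<psi> v)" "a + \<rho> v"] ell_pos[OF nn(2)] a0
          by (intro divide_right_mono mult_right_mono) auto
      qed
      finally show "1 / ell (a + \<rho> v) * \<rho>' v - 1 / ell (a + a * v) * a \<le> 0"
        using ell_pos[OF nn(1)] by (simp add: field_simps)
    qed
    moreover have "primitive (a + ?r b) \<le> primitive (a + \<rho> b)"
    proof (cases "?r b = \<rho> b")
      case False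
      then have "a + ?r b < a + \<rho> b" using r_le[of b] by linarith
      then show ?thesis
        using primitive_strict_mono[of "a + ?r b" "a + \<rho> b"] a0 by simp
    qed simp
    moreover have "\<rho> 0 = \<eta>" using \<eta> by (simp add: \<rho>_def)
    ultimately show ?thesis by simp
  qed
  have "isCont primitive a"
    using primitive_deriv[OF a0] by (rule DERIV_isCont)
  moreover have "((\<lambda>\<eta>. a + \<eta>) \<longlongrightarrow> a) (at_right (0::real))"
    using tendsto_add[OF tendsto_const[of a] tendsto_ident_at[of 0 "{0<..}"]] by simp
  ultimately have "((\<lambda>\<eta>. primitive (a + \<eta>)) \<longlongrightarrow> primitive a) (at_right 0)"
    by (rule isCont_tendsto_compose)
  then have "((\<lambda>\<eta>. primitive (a + a * b) - primitive a + primitive (a + \<eta>)) \<longlongrightarrow>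
      primitive (a + a * b) - primitive a + primitive a) (at_right 0)"
    by (rule tendsto_add[OF tendsto_const])
  then have "primitive (a + ?r b) \<le> primitive (a + a * b) - primitive a + primitive a"
  proof (rule tendsto_lowerbound)
    show "\<forall>\<^sub>F \<eta> in at_right 0.
        primitive (a + ?r b) \<le> primitive (a + a * b) - primitive a + primitive (a + \<eta>)"
      using eventually_at_right_less[of 0] by eventually_elim (rule smoothed)
  qed simp
  moreover assume "\<not> ?r b \<le> a * b"
  ultimately show False
    using primitive_strict_mono[of "a + a * b" "a + ?r b"] a0 b by auto
qed

definition partial_step :: "real \<Rightarrow> real \<Rightarrow> real"
  where "partial_step a v = integral {0..v} (\<lambda>w. 1 / ell (a + a * w))"

lemma partial_step_0: "partial_step a 0 = 0"
  by (simp add: partial_step_def)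

lemma partial_step_1: "partial_step a 1 = step_size ell a"
  by (simp add: partial_step_def step_size_def)

lemma continuous_on_inverse_ell:
  assumes "0 \<le> a"
  shows "continuous_on {0..1} (\<lambda>w. 1 / ell (a + a * w))"
proof (intro continuous_intros)
  show "continuous_on {0..1} (\<lambda>w. ell (a + a * w))"
    by (rule continuous_on_compose2[OF ell_cont]) (use assms in \<open>auto intro!: continuous_intros\<close>)
  have "0 < ell (a + a * x)" if "x \<in> {0..1}" for x
    by (rule ell_pos) (use assms that in auto)
  then show "\<forall>x\<in>{0..1}. ell (a + a * x) \<noteq> 0" by force
qed

lemma partial_step_deriv:
  assumes "0 \<le> a" "v \<in> {0..1}"
  shows "(partial_step a has_real_derivative 1 / ell (a + a * v)) (at v within {0..1})"
  using integral_has_real_derivative[OF continuous_on_inverse_ell[OF assms(1)] assms(2)]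
  by (simp add: partial_step_def[abs_def])

text \<open>
  The integrand of \<open>partial_step\<close> is nonincreasing, hence at least its value at the right endpoint.
\<close>

lemma partial_step_lower:
  assumes "0 \<le> a" "v \<in> {0..1}"
  shows "v / ell (a + a * v) \<le> partial_step a v"
proof -
  have "integral {0..v} (\<lambda>w. 1 / ell (a + a * v)) \<le> partial_step a v"
    unfolding partial_step_def
  proof (rule integral_le)
    show "(\<lambda>w. 1 / ell (a + a * w)) integrable_on {0..v}"
      by (rule integrable_continuous_interval)
        (rule continuous_on_subset[OF continuous_on_inverse_ell[OF assms(1)]], use assms in auto)
    fix w assume w: "w \<in> {0..v}"
    then have "a * w \<le> a * v" "0 \<le> a * w"
      using assms by (auto intro!: mult_left_mono)
    then show "1 / ell (a + a * v) \<le> 1 / ell (a + a * w)"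
      using assms ell_pos[of "a + a * w"] ell_le[of "a + a * w" "a + a * v"]
      by (intro divide_left_mono) auto
  qed (rule integrable_const_ivl)
  then show ?thesis using assms by simp
qed

lemma step_size_lower:
  assumes "0 \<le> a" "a \<le> M"
  shows "1 / ell (2 * M) \<le> step_size ell a"
proof -
  have "1 / ell (2 * M) \<le> 1 / ell (2 * a)"
    using assms ell_pos[of "2 * a"] ell_le[of "2 * a" "2 * M"] by (intro divide_left_mono) auto
  then show ?thesis
    using partial_step_lower[OF assms(1), of 1] by (simp add: partial_step_1)
qed

lemma step_size_pos:
  assumes "0 \<le> a"
  shows "0 < step_size ell a"
proof -
  have "0 < 1 / ell (2 * a)" using assms by (simp add: ell_pos)
  also have "\<dots> \<le> step_size ell a" using assms by (intro step_size_lower) auto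
  finally show ?thesis .
qed

end


section \<open>One gradient step\<close>

text \<open>
  The dimension enters nowhere, so the analysis of a step takes place in a linear subspace \<open>S\<close> of an
  arbitrary real inner product space, complete or not.  \<open>F\<close> is finite on its domain \<open>X\<close>, with
  gradient \<open>g\<close> and Hessian \<open>H\<close>; closedness of the sublevel sets in the whole space is what remains
  of the continuity of the extended-real-valued function up to the boundary of the domain.
\<close>

locale generalized_smooth = growth_bound ell for ell +
  fixes S X :: "'a::real_inner set" and F :: "'a \<Rightarrow> real" and g :: "'a \<Rightarrow> 'a"
    and H :: "'a \<Rightarrow> 'a \<Rightarrow> 'a"
  assumes S: "subspace S"
    and X_open: "openin (top_of_set S) X"
    and closed_sublevel: "closed {y \<in> X. F y \<le> \<alpha>}"
    and F_deriv: "x \<in> X \<Longrightarrow> (F has_derivative inner (g x)) (at x within S)"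
    and g_in: "x \<in> X \<Longrightarrow> g x \<in> S"
    and g_deriv: "x \<in> X \<Longrightarrow> (g has_derivative H x) (at x within S)"
    and H_bound: "x \<in> X \<Longrightarrow> v \<in> S \<Longrightarrow> norm (H x v) \<le> ell (norm (g x)) * norm v"
begin

lemma X_sub: "x \<in> X \<Longrightarrow> x \<in> S"
  using openin_imp_subset[OF X_open] by blast

lemma F_curve_deriv:
  assumes c: "(c has_vector_derivative c') (at v within I)"
    and "c v \<in> X" "c ` I \<subseteq> S"
  shows "((\<lambda>v. F (c v)) has_real_derivative inner (g (c v)) c') (at v within I)"
  using has_derivative_in_compose[OF c[unfolded has_vector_derivative_def]
      has_derivative_subset[OF F_deriv[OF assms(2)] assms(3)]]
  by (simp add: has_field_derivative_def o_def mult.commute[of _ "inner _ _"])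

lemma g_curve_deriv:
  assumes c: "(c has_vector_derivative c') (at v within I)"
    and "c v \<in> X" "c ` I \<subseteq> S"
  shows "((\<lambda>v. g (c v)) has_vector_derivative H (c v) c') (at v within I)"
proof -
  have "linear (H (c v))"
    using has_derivative_linear[OF g_deriv[OF assms(2)]] .
  then show ?thesis
    using has_derivative_in_compose[OF c[unfolded has_vector_derivative_def]
        has_derivative_subset[OF g_deriv[OF assms(2)] assms(3)]]
    by (simp add: has_vector_derivative_def linear_scale)
qed

definition step_path :: "'a \<Rightarrow> real \<Rightarrow> 'a"
  where "step_path x v = x - partial_step (norm (g x)) v *\<^sub>R g x"

lemma step_path_0: "step_path x 0 = x"
  by (simp add: step_path_def partial_step_0)

lemma step_path_1: "step_path x 1 = x - step_size ell (norm (g x)) *\<^sub>R g x"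
  by (simp add: step_path_def partial_step_1)

lemma step_path_in_S: "x \<in> X \<Longrightarrow> step_path x v \<in> S"
  unfolding step_path_def
  by (intro subspace_diff[OF S] subspace_scale[OF S] g_in X_sub)

lemma step_path_deriv:
  assumes "x \<in> X" "v \<in> {0..1}"
  shows "(step_path x has_vector_derivative (- (1 / ell (norm (g x) + norm (g x) * v))) *\<^sub>R g x)
    (at v within {0..1})"
  using partial_step_deriv[OF norm_ge_zero assms(2), of "g x"]
  unfolding step_path_def[abs_def] has_vector_derivative_def has_field_derivative_def
  by (auto intro!: derivative_eq_intros simp: fun_eq_iff)

lemma step_path_gradient_deriv:
  assumes "x \<in> X" "v \<in> {0..1}" "step_path x v \<in> X"
  shows "((\<lambda>v. g (step_path x v)) has_vector_derivative
    (- (1 / ell (norm (g x) + norm (g x) * v))) *\<^sub>R H (step_path x v) (g x)) (at v within {0..1})"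
proof -
  have "linear (H (step_path x v))"
    using has_derivative_linear[OF g_deriv[OF assms(3)]] .
  then show ?thesis
    using g_curve_deriv[OF step_path_deriv[OF assms(1,2)] assms(3)] step_path_in_S[OF assms(1)]
    by (simp add: linear_scale image_subset_iff linear_neg)
qed

text \<open>
  The velocity of the path is chosen so that the Hessian bound along it is the hypothesis of
  \<open>curve_displacement_bound\<close>.
\<close>

lemma gradient_change_le:
  assumes x: "x \<in> X" and b: "0 \<le> b" "b \<le> 1" and "\<And>v. v \<in> {0..b} \<Longrightarrow> step_path x v \<in> X"
  shows "norm (g (step_path x b) - g x) \<le> norm (g x) * b"
proof -
  let ?a = "norm (g x)"
  have "norm (g (step_path x b) - g (step_path x 0)) \<le> ?a * b"
  proof (rule curve_displacement_bound[OF b(1)])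
    show "norm (g (step_path x 0)) = ?a" by (simp add: step_path_0)
    fix v assume v: "v \<in> {0..b}"
    then have v1: "v \<in> {0..1}" using b by auto
    show "((\<lambda>v. g (step_path x v)) has_vector_derivative
        (- (1 / ell (?a + ?a * v))) *\<^sub>R H (step_path x v) (g x)) (at v within {0..b})"
      by (rule has_vector_derivative_within_subset[OF step_path_gradient_deriv[OF x v1 assms(4)[OF v]]])
        (use b in auto)
    have "0 < ell (?a + ?a * v)" using v by (intro ell_pos) auto
    then show "norm ((- (1 / ell (?a + ?a * v))) *\<^sub>R H (step_path x v) (g x))
        \<le> ell (norm (g (step_path x v))) * ?a / ell (?a + ?a * v)"
      using H_bound[OF assms(4)[OF v] g_in[OF x]]
      by (simp add: divide_right_mono)
  qed
  then show ?thesis by (simp add: step_path_0)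
qed

text \<open>
  By \<open>gradient_change_le\<close> the value decreases at rate at least \<open>(1 - v) (norm (g x))\<^sup>2 \<kappa>'(v)\<close>, where \<open>\<kappa>\<close> is
  \<open>partial_step (norm (g x))\<close>.  The left-hand side, as a function of \<open>b\<close>, then has derivative at most
  \<open>(norm (g x))\<^sup>2 (v \<kappa>'(v) - \<kappa>(v)) / 2\<close>, which is nonpositive by \<open>partial_step_lower\<close>.
\<close>

lemma descent_along_path:
  assumes x: "x \<in> X" and b: "0 \<le> b" "b \<le> 1" and "\<And>v. v \<in> {0..b} \<Longrightarrow> step_path x v \<in> X"
  shows "F (step_path x b) + (norm (g x))\<^sup>2 * (partial_step (norm (g x)) b * (1 - b / 2)) \<le> F x"
proof -
  let ?a = "norm (g x)"
  let ?m = "\<lambda>v. 1 / ell (?a + ?a * v)"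
  have "F (step_path x b) + ?a\<^sup>2 * (partial_step ?a b * (1 - b / 2))
      \<le> F (step_path x 0) + ?a\<^sup>2 * (partial_step ?a 0 * (1 - 0 / 2))"
  proof (rule nonincreasing_of_nonpos_derivative[OF b(1),
        where f' = "\<lambda>v. - ?m v * inner (g (step_path x v)) (g x)
          + ?a\<^sup>2 * (?m v * (1 - v / 2) - partial_step ?a v / 2)"])
    fix v assume v: "v \<in> {0..b}"
    then have v1: "v \<in> {0..1}" using b by auto
    have "((\<lambda>v. F (step_path x v)) has_real_derivative - ?m v * inner (g (step_path x v)) (g x))
        (at v within {0..1})"
      using F_curve_deriv[OF step_path_deriv[OF x v1] assms(4)[OF v]] step_path_in_S[OF x]
      by (simp add: image_subset_iff)
    moreover have "((\<lambda>v. 1 - v / 2) has_real_derivative - 1 / 2) (at v within {0..1})"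
      by (auto intro!: derivative_eq_intros)
    from DERIV_mult[OF partial_step_deriv[OF norm_ge_zero v1, of "g x"] this]
    have "((\<lambda>v. partial_step ?a v * (1 - v / 2)) has_real_derivative
        ?m v * (1 - v / 2) - partial_step ?a v / 2) (at v within {0..1})"
      by simp
    ultimately have "((\<lambda>v. F (step_path x v) + ?a\<^sup>2 * (partial_step ?a v * (1 - v / 2)))
        has_real_derivative - ?m v * inner (g (step_path x v)) (g x)
          + ?a\<^sup>2 * (?m v * (1 - v / 2) - partial_step ?a v / 2)) (at v within {0..1})"
      by (intro DERIV_add DERIV_cmult)
    then show "((\<lambda>v. F (step_path x v) + ?a\<^sup>2 * (partial_step ?a v * (1 - v / 2)))
        has_real_derivative - ?m v * inner (g (step_path x v)) (g x)
          + ?a\<^sup>2 * (?m v * (1 - v / 2) - partial_step ?a v / 2)) (at v within {0..b})"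
      by (rule DERIV_subset) (use b in auto)
    have "\<bar>inner (g (step_path x v) - g x) (g x)\<bar> \<le> norm (g (step_path x v) - g x) * ?a"
      by (rule Cauchy_Schwarz_ineq2)
    also have "\<dots> \<le> ?a * v * ?a"
      using v b by (intro mult_right_mono gradient_change_le[OF x]) (auto intro: assms(4))
    finally have "?a\<^sup>2 * (1 - v) \<le> inner (g (step_path x v)) (g x)"
      by (auto simp: inner_diff_left power2_norm_eq_inner[symmetric] power2_eq_square algebra_simps)
    moreover have m: "0 < ?m v" using v by (auto intro!: ell_pos)
    ultimately have "?m v * (?a\<^sup>2 * (1 - v)) \<le> ?m v * inner (g (step_path x v)) (g x)"
      by (intro mult_left_mono) auto
    moreover have "?a\<^sup>2 * (v * ?m v) \<le> ?a\<^sup>2 * partial_step ?a v"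
      using partial_step_lower[OF norm_ge_zero v1, of "g x"] by (intro mult_left_mono) auto
    moreover have "- m * i + a * (m * (1 - v / 2) - k / 2) \<le> 0"
      if "m * (a * (1 - v)) \<le> m * i" "a * (v * m) \<le> a * k" for m a i k :: real
      using that by (simp add: algebra_simps)
    ultimately show "- ?m v * inner (g (step_path x v)) (g x)
        + ?a\<^sup>2 * (?m v * (1 - v / 2) - partial_step ?a v / 2) \<le> 0"
      by blast
  qed
  then show ?thesis by (simp add: step_path_0 partial_step_0)
qed

text \<open>
  Up to the first exit time from the open set \<open>X\<close> the path stays in the sublevel set of its starting
  point; this set is closed and therefore contains the exit point as well.
\<close>

lemma step_path_in_X:
  assumes x: "x \<in> X" and "v \<in> {0..1}"
  shows "step_path x v \<in> X"
proof (rule ccontr)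
  assume "step_path x v \<notin> X"
  define Z where "Z = {v \<in> {0..1}. step_path x v \<in> S - X}"
  have Z: "v \<in> Z" using assms \<open>step_path x v \<notin> X\<close> step_path_in_S[OF x] by (simp add: Z_def)
  have cont: "continuous_on {0..1} (step_path x)"
    unfolding continuous_on_eq_continuous_within
    using has_vector_derivative_continuous[OF step_path_deriv[OF x]] by blast
  obtain U where U: "open U" "X = S \<inter> U"
    using X_open by (auto simp: openin_open)
  have "Z = {0..1} \<inter> step_path x -` (- U)"
    using step_path_in_S[OF x] U by (auto simp: Z_def)
  moreover have "closed ({0..1} \<inter> step_path x -` (- U))"
    using U by (intro continuous_closed_preimage cont) auto
  ultimately have "closed Z" by simp
  moreover have "bdd_below Z" by (auto simp: Z_def intro!: bdd_belowI[of _ 0])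
  ultimately have v0: "Inf Z \<in> Z" using Z by (intro closed_contains_Inf) auto
  define v0 where "v0 = Inf Z"
  have before: "step_path x w \<in> X" if "0 \<le> w" "w < v0" for w
  proof (rule ccontr)
    assume "step_path x w \<notin> X"
    then have "w \<in> Z" using that v0 step_path_in_S[OF x] by (auto simp: Z_def v0_def)
    then show False using that cInf_lower[OF _ \<open>bdd_below Z\<close>] v0_def by force
  qed
  have v0': "v0 \<in> {0..1}" "step_path x v0 \<notin> X" using v0 by (auto simp: Z_def v0_def)
  then have "0 < v0" using step_path_0[of x] x by (cases "v0 = 0") auto
  have "step_path x w \<in> {y \<in> X. F y \<le> F x}" if "0 \<le> w" "w < v0" for w
  proof -
    have w: "w \<le> 1" using that v0' by auto
    have "0 \<le> w / ell (norm (g x) + norm (g x) * w)"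
      using that by (intro divide_nonneg_pos ell_pos) auto
    also have "\<dots> \<le> partial_step (norm (g x)) w"
      using that w by (intro partial_step_lower) auto
    finally have "0 \<le> (norm (g x))\<^sup>2 * (partial_step (norm (g x)) w * (1 - w / 2))"
      using w by auto
    moreover have "F (step_path x w) + (norm (g x))\<^sup>2 * (partial_step (norm (g x)) w * (1 - w / 2)) \<le> F x"
      using that w by (intro descent_along_path[OF x]) (auto intro!: before)
    ultimately show ?thesis using before[OF that] by simp
  qed
  then have "\<forall>\<^sub>F w in at_left v0. step_path x w \<in> {y \<in> X. F y \<le> F x}"
    using \<open>0 < v0\<close> by (auto simp: eventually_at_left_field intro!: exI[of _ 0])
  moreover have "(step_path x \<longlongrightarrow> step_path x v0) (at_left v0)"
  proof -
    have "(step_path x \<longlongrightarrow> step_path x v0) (at v0 within {0..v0})"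
      by (rule tendsto_within_subset[of _ _ _ "{0..1}"])
        (use cont v0' in \<open>auto simp: continuous_on\<close>)
    then show ?thesis using \<open>0 < v0\<close> by (simp add: at_within_Icc_at_left)
  qed
  ultimately have "step_path x v0 \<in> {y \<in> X. F y \<le> F x}"
    by (intro Lim_in_closed_set[OF closed_sublevel]) auto
  with v0' show False by simp
qed

lemma step_in_X:
  assumes "x \<in> X"
  shows "x - step_size ell (norm (g x)) *\<^sub>R g x \<in> X"
  using step_path_in_X[OF assms, of 1] by (simp add: step_path_1)

lemma step_descent:
  assumes "x \<in> X"
  shows "F (x - step_size ell (norm (g x)) *\<^sub>R g x)
    \<le> F x - step_size ell (norm (g x)) / 2 * (norm (g x))\<^sup>2"
  using descent_along_path[OF assms, of 1] step_path_in_X[OF assms]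
  by (simp add: step_path_1 partial_step_1 algebra_simps)

end


section \<open>Convexity and cocoercivity of the gradient\<close>

locale convex_generalized_smooth = generalized_smooth ell S X F g H for ell S X F g H +
  assumes convex: "convex_on X F"
begin

lemma above_tangent:
  assumes y: "y \<in> X" and z: "z \<in> X"
  shows "F y + inner (g y) (z - y) \<le> F z"
proof -
  let ?p = "\<lambda>t. y + t *\<^sub>R (z - y)"
  have "(?p has_vector_derivative (z - y)) (at 0 within {0..1})"
    by (auto intro!: derivative_eq_intros simp: has_vector_derivative_def)
  then have "((\<lambda>t. F (?p t)) has_real_derivative inner (g (?p 0)) (z - y)) (at 0 within {0..1})"
    by (rule F_curve_deriv)
      (use y X_sub[OF y] X_sub[OF z] in
        \<open>auto intro!: subspace_add[OF S] subspace_scale[OF S] subspace_diff[OF S]\<close>)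
  then have "((\<lambda>t. (F (?p t) - F y) / t) \<longlongrightarrow> inner (g y) (z - y)) (at 0 within {0..1})"
    by (simp add: has_field_derivative_iff)
  moreover have "\<forall>\<^sub>F t in at 0 within {0..1}. (F (?p t) - F y) / t \<le> F z - F y"
  proof (unfold eventually_at_filter, rule always_eventually, intro allI impI)
    fix t :: real assume t: "t \<noteq> 0" "t \<in> {0..1}"
    have "?p t = (1 - t) *\<^sub>R y + t *\<^sub>R z"
      by (simp add: algebra_simps)
    then have "F (?p t) \<le> (1 - t) * F y + t * F z"
      using convex_onD[OF convex, of t y z] t y z by simp
    then show "(F (?p t) - F y) / t \<le> F z - F y"
      using t by (simp add: field_simps)
  qed
  moreover have "at (0::real) within {0..1} \<noteq> bot"
    by (simp add: at_within_Icc_at_right)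
  ultimately have "inner (g y) (z - y) \<le> F z - F y"
    by (intro tendsto_upperbound)
  then show ?thesis by simp
qed

lemma segment_path:
  assumes "convex B" "B \<subseteq> X" "y \<in> B" "z \<in> B" "t \<in> {0..1}"
  shows "y + t *\<^sub>R (z - y) \<in> B"
proof -
  have "(1 - t) *\<^sub>R y + t *\<^sub>R z \<in> B"
    using assms by (intro convexD_alt) auto
  then show ?thesis by (simp add: algebra_simps)
qed

text \<open>
  The mean value theorem is applied to the component of the gradient in the direction of its own
  total change, because it fails for vector-valued functions.
\<close>

lemma gradient_lipschitz_on_convex:
  assumes B: "convex B" "B \<subseteq> X" and L: "\<And>w. w \<in> B \<Longrightarrow> ell (norm (g w)) \<le> L"
    and yz: "y \<in> B" "z \<in> B"
  shows "norm (g z - g y) \<le> L * norm (z - y)"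
proof -
  let ?p = "\<lambda>t. y + t *\<^sub>R (z - y)"
  let ?w = "g z - g y"
  have zy: "z - y \<in> S" using yz B X_sub subspace_diff[OF S] by blast
  have "((\<lambda>t. inner (g (?p t)) ?w) has_derivative (\<lambda>s. inner (s *\<^sub>R H (?p t) (z - y)) ?w))
      (at t within {0..1})" if t: "t \<in> {0..1}" for t
  proof -
    have "(?p has_vector_derivative (z - y)) (at t within {0..1})"
      by (auto intro!: derivative_eq_intros simp: has_vector_derivative_def)
    then have "((\<lambda>t. g (?p t)) has_vector_derivative H (?p t) (z - y)) (at t within {0..1})"
      by (rule g_curve_deriv)
        (use segment_path[OF B yz] B(2) t in \<open>auto intro!: X_sub\<close>)
    then show ?thesis
      unfolding has_vector_derivative_def by (rule has_derivative_inner_left)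
  qed
  then obtain t where t: "t \<in> {0..1}"
    "inner (g (?p 1)) ?w - inner (g (?p 0)) ?w = inner ((1 - 0) *\<^sub>R H (?p t) (z - y)) ?w"
    using mvt_very_simple[of 0 1 "\<lambda>t. inner (g (?p t)) ?w"
        "\<lambda>t s. inner (s *\<^sub>R H (?p t) (z - y)) ?w"] by auto
  have pt: "?p t \<in> B" by (rule segment_path[OF B yz t(1)])
  have "(norm ?w)\<^sup>2 = inner (H (?p t) (z - y)) ?w"
    using t(2) by (simp add: power2_norm_eq_inner inner_diff_left)
  also have "\<dots> \<le> norm (H (?p t) (z - y)) * norm ?w"
    by (rule norm_cauchy_schwarz)
  also have "\<dots> \<le> (L * norm (z - y)) * norm ?w"
  proof (rule mult_right_mono)
    have "norm (H (?p t) (z - y)) \<le> ell (norm (g (?p t))) * norm (z - y)"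
      using H_bound pt B zy by blast
    also have "\<dots> \<le> L * norm (z - y)"
      by (rule mult_right_mono[OF L[OF pt]]) simp
    finally show "norm (H (?p t) (z - y)) \<le> L * norm (z - y)" .
  qed simp
  finally have "norm ?w * norm ?w \<le> (L * norm (z - y)) * norm ?w"
    by (simp add: power2_eq_square)
  moreover have "0 \<le> L"
    using L[OF yz(1)] ell_pos[of "norm (g y)"] by simp
  ultimately show ?thesis
    by (cases "?w = 0") auto
qed

lemma quadratic_upper_bound_on_convex:
  assumes B: "convex B" "B \<subseteq> X" and L: "\<And>w. w \<in> B \<Longrightarrow> ell (norm (g w)) \<le> L"
    and yz: "y \<in> B" "z \<in> B"
  shows "F z \<le> F y + inner (g y) (z - y) + L / 2 * (norm (z - y))\<^sup>2"
proof -
  let ?p = "\<lambda>t. y + t *\<^sub>R (z - y)"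
  let ?d = "\<lambda>t. F (?p t) - t * inner (g y) (z - y) - t\<^sup>2 * (L / 2 * (norm (z - y))\<^sup>2)"
  have "?d 1 \<le> ?d 0"
  proof (rule nonincreasing_of_nonpos_derivative[where f = ?d and
        f' = "\<lambda>t. inner (g (?p t)) (z - y) - inner (g y) (z - y) - 2 * t * (L / 2 * (norm (z - y))\<^sup>2)"])
    fix t :: real assume t: "t \<in> {0..1}"
    have "(?p has_vector_derivative (z - y)) (at t within {0..1})"
      by (auto intro!: derivative_eq_intros simp: has_vector_derivative_def)
    then have "((\<lambda>t. F (?p t)) has_real_derivative inner (g (?p t)) (z - y)) (at t within {0..1})"
      by (rule F_curve_deriv)
        (use segment_path[OF B yz] B(2) t in \<open>auto intro!: X_sub\<close>)
    then show "(?d has_real_derivative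
        inner (g (?p t)) (z - y) - inner (g y) (z - y) - 2 * t * (L / 2 * (norm (z - y))\<^sup>2))
        (at t within {0..1})"
      by (intro DERIV_diff) (auto intro!: derivative_eq_intros)
    have "inner (g (?p t) - g y) (z - y) \<le> norm (g (?p t) - g y) * norm (z - y)"
      by (rule norm_cauchy_schwarz)
    also have "\<dots> \<le> L * norm (?p t - y) * norm (z - y)"
      by (intro mult_right_mono gradient_lipschitz_on_convex[OF B L yz(1)] segment_path[OF B yz t]) auto
    also have "\<dots> = t * L * (norm (z - y))\<^sup>2"
      using t by (simp add: power2_eq_square)
    finally show "inner (g (?p t)) (z - y) - inner (g y) (z - y)
        - 2 * t * (L / 2 * (norm (z - y))\<^sup>2) \<le> 0"
      by (simp add: inner_diff_left)
  qed simp
  then show ?thesis by simp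
qed

text \<open>
  Let \<open>z\<close> be the result of a gradient step of size \<open>1 / L\<close> from \<open>y\<close> for the function
  \<open>\<lambda>z. F z - inner (g p) z\<close>, which is minimal at \<open>p\<close>.  Its value at \<open>z\<close> is bounded from below by convexity
  and from above by \<open>quadratic_upper_bound_on_convex\<close>.
\<close>

lemma interpolation_inequality:
  assumes B: "convex B" "B \<subseteq> X" and L: "\<And>w. w \<in> B \<Longrightarrow> ell (norm (g w)) \<le> L"
    and yz: "p \<in> B" "y \<in> B" "y - (1 / L) *\<^sub>R (g y - g p) \<in> B"
  shows "F p + inner (g p) (y - p) + (norm (g y - g p))\<^sup>2 / (2 * L) \<le> F y"
proof -
  let ?w = "g y - g p"
  let ?z = "y - (1 / L) *\<^sub>R ?w"
  have L0: "0 < L"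
    using L[OF yz(1)] ell_pos[of "norm (g p)"] by simp
  have "F p + inner (g p) (?z - p) \<le> F ?z"
    using above_tangent B(2) yz by blast
  moreover have "F ?z \<le> F y + inner (g y) (?z - y) + L / 2 * (norm (?z - y))\<^sup>2"
    by (rule quadratic_upper_bound_on_convex[OF B L yz(2,3)])
  moreover have "norm (?z - y) = norm ?w / L"
    using L0 by simp
  then have "L / 2 * (norm (?z - y))\<^sup>2 = (norm ?w)\<^sup>2 / (2 * L)"
    using L0 by (simp only: power_divide) (simp add: power2_eq_square field_simps)
  moreover have "inner (g y) (?z - y) - inner (g p) (?z - p) = - (norm ?w)\<^sup>2 / L - inner (g p) (y - p)"
  proof -
    have "inner (g y) (?z - y) = - (inner (g y) ?w / L)"
      by simp
    moreover have "?z - p = (y - p) - (1 / L) *\<^sub>R ?w"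
      by simp
    then have "inner (g p) (?z - p) = inner (g p) (y - p) - inner (g p) ?w / L"
      by (simp only: inner_diff_right inner_scaleR_right) simp
    moreover have "(norm ?w)\<^sup>2 = inner (g y) ?w - inner (g p) ?w"
      unfolding power2_norm_eq_inner inner_diff_left ..
    ultimately show ?thesis by (simp add: diff_divide_distrib)
  qed
  moreover have "(norm ?w)\<^sup>2 / L = (norm ?w)\<^sup>2 / (2 * L) + (norm ?w)\<^sup>2 / (2 * L)"
    using L0 by simp
  ultimately show ?thesis
    by linarith
qed

text \<open>
  Near \<open>p\<close> the Hessians are bounded by \<open>L\<close>.  The claim is the sum of two interpolation inequalities
  with the roles of \<open>p\<close> and \<open>y\<close> exchanged.
\<close>

lemma locally_cocoercive:
  assumes p: "p \<in> X" and L: "ell (norm (g p)) < L"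
  obtains r where "0 < r"
    "\<And>y. y \<in> S \<Longrightarrow> norm (y - p) < r \<Longrightarrow> (norm (g y - g p))\<^sup>2 \<le> L * inner (g y - g p) (y - p)"
proof -
  have L0: "0 < L" using ell_pos[of "norm (g p)"] L by simp
  have "continuous (at p within S) (\<lambda>y. norm (g y))"
    using has_derivative_continuous[OF g_deriv[OF p]] by (rule continuous_norm)
  moreover have "continuous (at (norm (g p)) within {0..}) ell"
    using bspec[OF ell_cont[unfolded continuous_on_eq_continuous_within], of "norm (g p)"] by simp
  then have "continuous (at (norm (g p)) within (\<lambda>y. norm (g y)) ` S) ell"
    by (rule continuous_within_subset) (simp add: image_subset_iff)
  ultimately have "continuous (at p within S) (\<lambda>y. ell (norm (g y)))"
    by (rule continuous_within_compose2[where f = "\<lambda>y. norm (g y)" and g = ell])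
  then have "\<forall>\<^sub>F y in at p within S. ell (norm (g y)) < L"
    unfolding continuous_within using L by (rule order_tendstoD(2))
  then obtain r1 where r1: "0 < r1" "\<And>y. y \<in> S \<Longrightarrow> dist y p < r1 \<Longrightarrow> ell (norm (g y)) \<le> L"
  proof -
    obtain r1 where "0 < r1" "\<forall>y\<in>S. y \<noteq> p \<and> dist y p < r1 \<longrightarrow> ell (norm (g y)) < L"
      using \<open>\<forall>\<^sub>F y in at p within S. ell (norm (g y)) < L\<close> unfolding eventually_at by blast
    then show ?thesis
      using L that[of r1] by force
  qed
  obtain U where U: "open U" "X = S \<inter> U"
    using X_open by (auto simp: openin_open)
  then obtain r2 where r2: "0 < r2" "ball p r2 \<subseteq> U"
    using p by (auto simp: open_contains_ball)
  define r where "r = min r1 r2"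
  define B where "B = S \<inter> ball p r"
  have B: "convex B" "B \<subseteq> X" "\<And>w. w \<in> B \<Longrightarrow> ell (norm (g w)) \<le> L"
  proof -
    show "convex B"
      unfolding B_def by (intro convex_Int subspace_imp_convex S convex_ball)
    show "B \<subseteq> X"
      using r2(2) U(2) by (auto simp: B_def r_def)
    show "ell (norm (g w)) \<le> L" if "w \<in> B" for w
      using that by (intro r1(2)) (auto simp: B_def r_def dist_commute)
  qed
  have pB: "p \<in> B" using r1 r2 p X_sub by (simp add: B_def r_def)
  show ?thesis
  proof
    \<comment> \<open>The auxiliary points of the interpolation inequalities are at most twice as far from \<open>p\<close> as
      \<open>y\<close> is, so half the radius keeps them in \<open>B\<close>.\<close>
    show "0 < r / 2" using r1 r2 by (simp add: r_def)
    fix y assume y: "y \<in> S" "norm (y - p) < r / 2"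
    then have "norm (y - p) < r"
      using norm_ge_zero[of "y - p"] by linarith
    then have yB: "y \<in> B"
      using y(1) by (simp add: B_def dist_norm norm_minus_commute)
    have lip: "norm ((1 / L) *\<^sub>R (g y - g p)) \<le> norm (y - p)"
    proof -
      have "norm ((1 / L) *\<^sub>R w) = norm w / L" for w :: 'a
        using L0 by simp
      then show ?thesis
        using gradient_lipschitz_on_convex[OF B pB yB] L0 by (simp only: pos_divide_le_eq mult.commute)
    qed
    have gS: "g y \<in> S" "g p \<in> S" using g_in pB yB B(2) by auto
    have inB: "z - s \<in> B" if "z \<in> S" "s \<in> S" "norm (z - p) + norm s < r" for z s
    proof -
      have "norm ((z - p) - s) < r"
        using norm_triangle_ineq4[of "z - p" s] that(3) by linarith
      moreover have "(z - p) - s = (z - s) - p" by simp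
      ultimately have "norm ((z - s) - p) < r" by simp
      then show ?thesis
        using subspace_diff[OF S that(1,2)] by (simp add: B_def dist_norm norm_minus_commute)
    qed
    have z1: "y - (1 / L) *\<^sub>R (g y - g p) \<in> B"
      using lip y(2) by (intro inB y(1) subspace_scale[OF S] subspace_diff[OF S] gS) linarith
    have "norm ((1 / L) *\<^sub>R (g p - g y)) = norm ((1 / L) *\<^sub>R (g y - g p))"
      unfolding norm_scaleR by (simp only: norm_minus_commute)
    then have z2: "p - (1 / L) *\<^sub>R (g p - g y) \<in> B"
      using lip y(2) norm_ge_zero[of "y - p"] norm_zero[where 'a = 'a]
      by (intro inB subspace_scale[OF S] subspace_diff[OF S] gS X_sub[OF p]) (simp only: diff_self)
    have "(norm (g y - g p))\<^sup>2 / (2 * L) + (norm (g p - g y))\<^sup>2 / (2 * L)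
        \<le> - inner (g p) (y - p) - inner (g y) (p - y)"
      using interpolation_inequality[OF B pB yB z1] interpolation_inequality[OF B yB pB z2] by linarith
    moreover have "(norm (g y - g p))\<^sup>2 / (2 * L) + (norm (g p - g y))\<^sup>2 / (2 * L)
        = (norm (g y - g p))\<^sup>2 / L"
      by (simp add: norm_minus_commute[of "g p"])
    moreover have "- inner (g p) (y - p) - inner (g y) (p - y) = inner (g y - g p) (y - p)"
      by (simp add: inner_diff_left inner_diff_right)
    ultimately have "(norm (g y - g p))\<^sup>2 / L \<le> inner (g y - g p) (y - p)"
      by simp
    then show "(norm (g y - g p))\<^sup>2 \<le> L * inner (g y - g p) (y - p)"
      using L0 by (simp add: field_simps)
  qed
qed

text \<open>
  This is the limit of \<open>locally_cocoercive\<close> for \<open>y\<close> tending to \<open>p\<close> in direction \<open>u\<close>, followed by \<open>L\<close> tending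
  to \<open>ell (norm (g p))\<close>.  It stands in for the positive semidefiniteness and the symmetry of the Hessian.
\<close>

lemma hessian_cocoercive:
  assumes p: "p \<in> X" and u: "u \<in> S"
  shows "(norm (H p u))\<^sup>2 \<le> ell (norm (g p)) * inner (H p u) u"
proof -
  let ?q = "\<lambda>t. (1 / t) *\<^sub>R (g (p + t *\<^sub>R u) - g p)"
  have "((\<lambda>t. p + t *\<^sub>R u) has_vector_derivative u) (at 0)"
    by (auto intro!: derivative_eq_intros simp: has_vector_derivative_def)
  then have "((\<lambda>t. g (p + t *\<^sub>R u)) has_vector_derivative H (p + 0 *\<^sub>R u) u) (at 0)"
    by (rule g_curve_deriv)
      (use p X_sub[OF p] u in \<open>auto intro!: subspace_add[OF S] subspace_scale[OF S]\<close>)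
  then have "((\<lambda>t. norm (g (p + t *\<^sub>R u) - g p - t *\<^sub>R H p u) / \<bar>t\<bar>) \<longlongrightarrow> 0) (at 0)"
    by (simp add: has_vector_derivative_def has_derivative_at)
  moreover have "\<forall>\<^sub>F t in at 0.
      norm (g (p + t *\<^sub>R u) - g p - t *\<^sub>R H p u) / \<bar>t\<bar> = norm (?q t - H p u)"
    using eventually_neq_at_within[of 0 0 UNIV]
  proof eventually_elim
    case (elim t)
    then have "?q t - H p u = (1 / t) *\<^sub>R (g (p + t *\<^sub>R u) - g p - t *\<^sub>R H p u)"
      by (simp add: scaleR_diff_right)
    then show ?case by (simp only: norm_scaleR) simp
  qed
  ultimately have "((\<lambda>t. norm (?q t - H p u)) \<longlongrightarrow> 0) (at 0)"
    by (rule Lim_transform_eventually)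
  then have q: "(?q \<longlongrightarrow> H p u) (at 0)"
    unfolding tendsto_norm_zero_iff by (rule LIM_zero_cancel)
  have bound: "(norm (H p u))\<^sup>2 \<le> L * inner (H p u) u" if L: "ell (norm (g p)) < L" for L
  proof (rule tendsto_le)
    show "((\<lambda>t. (norm (?q t))\<^sup>2) \<longlongrightarrow> (norm (H p u))\<^sup>2) (at 0)"
      by (intro tendsto_intros q)
    show "((\<lambda>t. L * inner (?q t) u) \<longlongrightarrow> L * inner (H p u) u) (at 0)"
      by (intro tendsto_intros q)
    obtain r where r: "0 < r"
      "\<And>y. y \<in> S \<Longrightarrow> norm (y - p) < r \<Longrightarrow> (norm (g y - g p))\<^sup>2 \<le> L * inner (g y - g p) (y - p)"
      using locally_cocoercive[OF p L] by blast
    have "((\<lambda>t. norm (t *\<^sub>R u)) \<longlongrightarrow> norm (0 *\<^sub>R u)) (at 0)"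
      by (intro tendsto_intros)
    then have "\<forall>\<^sub>F t in at 0. norm (t *\<^sub>R u) < r"
      using r(1) by (intro order_tendstoD) auto
    then show "\<forall>\<^sub>F t in at 0. (norm (?q t))\<^sup>2 \<le> L * inner (?q t) u"
      using eventually_neq_at_within[of 0 0 UNIV]
    proof eventually_elim
      case (elim t)
      let ?w = "g (p + t *\<^sub>R u) - g p"
      have "(norm ?w)\<^sup>2 \<le> L * inner ?w (p + t *\<^sub>R u - p)"
        by (rule r(2)) (use elim X_sub[OF p] u in \<open>auto intro!: subspace_add[OF S] subspace_scale[OF S]\<close>)
      then have "(norm ?w)\<^sup>2 / t\<^sup>2 \<le> (L * (t * inner ?w u)) / t\<^sup>2"
        by (intro divide_right_mono) auto
      moreover have "(norm ((1 / t) *\<^sub>R z))\<^sup>2 = (norm z)\<^sup>2 / t\<^sup>2"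
        "L * inner ((1 / t) *\<^sub>R z) u = (L * (t * inner z u)) / t\<^sup>2" for z :: 'a
        using elim by (auto simp: power_divide power2_eq_square)
      ultimately show ?case by (simp only:)
    qed
  qed simp
  have "((\<lambda>L. L * inner (H p u) u) \<longlongrightarrow> ell (norm (g p)) * inner (H p u) u)
      (at_right (ell (norm (g p))))"
    by (intro tendsto_intros)
  then show ?thesis
    by (rule tendsto_lowerbound)
      (use bound in \<open>auto intro!: eventually_mono[OF eventually_at_right_less]\<close>)
qed

text \<open>
  Let \<open>\<psi>\<close> be the gradient along the step and \<open>w\<close> its total change.  The speed of the path turns
  \<open>hessian_cocoercive\<close> into \<open>(norm (\<psi>' v))\<^sup>2 \<le> - inner (\<psi>' v) (g x)\<close>.  Since
  \<open>2 * inner (\<psi>' v) w - (norm w)\<^sup>2 \<le> (norm (\<psi>' v))\<^sup>2\<close>, integration over \<open>[0,1]\<close>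
  yields \<open>(norm w)\<^sup>2 \<le> - inner w (g x)\<close>.  The quadratic expansion of \<open>norm (g x + w)\<close> gives the
  claim.  Being linear in \<open>\<psi>' v\<close>, the lower bound has an explicit antiderivative, so that the integration
  reduces to the monotonicity of a differentiable real function.
\<close>

lemma step_gradient_norm_le:
  assumes x: "x \<in> X"
  shows "norm (g (x - step_size ell (norm (g x)) *\<^sub>R g x)) \<le> norm (g x)"
proof -
  let ?a = "norm (g x)"
  let ?m = "\<lambda>v. 1 / ell (?a + ?a * v)"
  let ?\<psi> = "\<lambda>v. g (step_path x v)"
  define w where "w = ?\<psi> 1 - ?\<psi> 0"
  let ?d = "\<lambda>v. 2 * inner (?\<psi> v) w + inner (?\<psi> v) (g x) - v * (norm w)\<^sup>2"
  have "?d 1 \<le> ?d 0"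
  proof (rule nonincreasing_of_nonpos_derivative[where f = ?d and
        f' = "\<lambda>v. 2 * inner ((- ?m v) *\<^sub>R H (step_path x v) (g x)) w
          + inner ((- ?m v) *\<^sub>R H (step_path x v) (g x)) (g x) - (norm w)\<^sup>2"])
    fix v :: real assume v: "v \<in> {0..1}"
    let ?\<psi>' = "(- ?m v) *\<^sub>R H (step_path x v) (g x)"
    have vX: "step_path x v \<in> X" by (rule step_path_in_X[OF x v])
    have "(?\<psi> has_vector_derivative ?\<psi>') (at v within {0..1})"
      by (rule step_path_gradient_deriv[OF x v vX])
    from has_derivative_inner_left[OF this[unfolded has_vector_derivative_def]]
    have deriv: "((\<lambda>v. inner (?\<psi> v) z) has_real_derivative inner ?\<psi>' z) (at v within {0..1})" for z
      unfolding has_field_derivative_def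
      by (rule has_derivative_eq_rhs) (simp add: fun_eq_iff)
    show "(?d has_real_derivative 2 * inner ?\<psi>' w + inner ?\<psi>' (g x) - (norm w)\<^sup>2) (at v within {0..1})"
      by (intro DERIV_diff DERIV_add DERIV_cmult deriv) (auto intro!: derivative_eq_intros)
    let ?h = "H (step_path x v) (g x)"
    have m: "0 < ell (?a + ?a * v)" using v by (intro ell_pos) auto
    have coc: "(norm ?h)\<^sup>2 \<le> ell (norm (?\<psi> v)) * inner ?h (g x)"
      by (rule hessian_cocoercive[OF vX g_in[OF x]])
    then have nn: "0 \<le> inner ?h (g x)"
      using ell_pos[of "norm (?\<psi> v)"] zero_le_power2[of "norm ?h"]
      by (metis norm_ge_zero order_trans zero_le_mult_iff not_le)
    have "norm (?\<psi> v) \<le> ?a + ?a * v"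
      using norm_triangle_sub[of "?\<psi> v" "g x"]
        gradient_change_le[OF x, of v] step_path_in_X[OF x] v by force
    then have "ell (norm (?\<psi> v)) * inner ?h (g x) \<le> ell (?a + ?a * v) * inner ?h (g x)"
      by (intro mult_right_mono ell_le nn) auto
    with coc have "(norm ?h)\<^sup>2 \<le> ell (?a + ?a * v) * inner ?h (g x)" by simp
    then have "(norm ?\<psi>')\<^sup>2 \<le> - inner ?\<psi>' (g x)"
      using m by (simp add: power_divide power2_eq_square field_simps)
    moreover have "0 \<le> (norm (?\<psi>' - w))\<^sup>2" by simp
    ultimately show "2 * inner ?\<psi>' w + inner ?\<psi>' (g x) - (norm w)\<^sup>2 \<le> 0"
      unfolding power2_norm_eq_inner inner_diff_left inner_diff_right
      by (simp add: inner_commute)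
  qed simp
  then have "(norm w)\<^sup>2 + inner w (g x) \<le> 0"
    by (simp add: w_def power2_norm_eq_inner inner_diff_left inner_diff_right)
  moreover have "(norm (g x + w))\<^sup>2 = ?a\<^sup>2 + 2 * inner w (g x) + (norm w)\<^sup>2"
    by (simp add: power2_norm_eq_inner inner_add_left inner_add_right inner_commute)
  moreover have "0 \<le> (norm w)\<^sup>2" by simp
  ultimately have "(norm (g x + w))\<^sup>2 \<le> ?a\<^sup>2" by linarith
  then have "norm (g x + w) \<le> ?a"
    by (rule power2_le_imp_le) simp
  then show ?thesis by (simp add: w_def step_path_0 step_path_1)
qed


section \<open>Convergence of the iteration\<close>

text \<open>
  The term \<open>\<gamma> / 2 * (norm (g x))\<^sup>2\<close> gained in \<open>step_descent\<close> is the one that completes the square when the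
  tangent inequality at \<open>x\<close> is evaluated at \<open>y\<close>.
\<close>

lemma distance_decrease:
  assumes x: "x \<in> X" and y: "y \<in> X"
  defines "\<gamma> \<equiv> step_size ell (norm (g x))"
  shows "\<gamma> * (F (x - \<gamma> *\<^sub>R g x) - F y) \<le> ((norm (x - y))\<^sup>2 - (norm (x - \<gamma> *\<^sub>R g x - y))\<^sup>2) / 2"
proof -
  have \<gamma>: "0 < \<gamma>"
    unfolding \<gamma>_def by (rule step_size_pos) simp
  have "F (x - \<gamma> *\<^sub>R g x) - F y \<le> inner (g x) (x - y) - \<gamma> / 2 * (norm (g x))\<^sup>2"
    using step_descent[OF x] above_tangent[OF x y] by (simp add: \<gamma>_def inner_diff_right)
  then have "\<gamma> * (F (x - \<gamma> *\<^sub>R g x) - F y) \<le> \<gamma> * (inner (g x) (x - y) - \<gamma> / 2 * (norm (g x))\<^sup>2)"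
    using \<gamma> by (intro mult_left_mono) auto
  also have "\<dots> = ((norm (x - y))\<^sup>2 - (norm ((x - y) - \<gamma> *\<^sub>R g x))\<^sup>2) / 2"
    unfolding power2_norm_eq_inner inner_diff_left[of "x - y" "\<gamma> *\<^sub>R g x"]
      inner_diff_right[of _ "x - y" "\<gamma> *\<^sub>R g x"]
    by (simp add: inner_commute[of x "g x"] inner_commute[of y "g x"] algebra_simps)
  also have "(x - y) - \<gamma> *\<^sub>R g x = x - \<gamma> *\<^sub>R g x - y" by simp
  finally show ?thesis .
qed

end

locale convex_gradient_descent = convex_generalized_smooth ell S X F g H for ell S X F g H +
  fixes x :: "nat \<Rightarrow> 'a::real_inner" and y :: 'a
  assumes start: "x 0 \<in> X"
    and iteration: "x (Suc k) = x k - step_size ell (norm (g (x k))) *\<^sub>R g (x k)"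
    and y: "y \<in> X" and minimal: "z \<in> X \<Longrightarrow> F y \<le> F z"
begin

lemma iterate_in_X: "x k \<in> X"
  by (induction k) (auto simp: start iteration intro: step_in_X)

lemma step_size_nonneg: "0 \<le> step_size ell (norm (g (x k)))"
  using step_size_pos[of "norm (g (x k))"] by simp

lemma value_decreasing:
  "F (x (Suc k)) \<le> F (x k) - step_size ell (norm (g (x k))) / 2 * (norm (g (x k)))\<^sup>2"
  using step_descent[OF iterate_in_X] by (simp add: iteration)

lemma value_antimono: "m \<le> n \<Longrightarrow> F (x n) \<le> F (x m)"
proof (rule lift_Suc_antimono_le[of "\<lambda>k. F (x k)"])
  fix k
  have "0 \<le> step_size ell (norm (g (x k))) / 2 * (norm (g (x k)))\<^sup>2"
    using step_size_nonneg by simp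
  with value_decreasing[of k] show "F (x (Suc k)) \<le> F (x k)" by linarith
qed

lemma gradient_norm_antimono: "m \<le> n \<Longrightarrow> norm (g (x n)) \<le> norm (g (x m))"
  by (rule lift_Suc_antimono_le[of "\<lambda>k. norm (g (x k))"])
    (auto simp: iteration intro: step_gradient_norm_le iterate_in_X)

text \<open>
  The inequalities \<open>distance_decrease\<close> telescope, and the last value gap is the smallest one.
\<close>

lemma value_gap_times_total_step:
  "(F (x T) - F y) * (\<Sum>k<T. step_size ell (norm (g (x k))))
    \<le> ((norm (x 0 - y))\<^sup>2 - (norm (x T - y))\<^sup>2) / 2"
proof (induction T)
  case (Suc T)
  let ?\<gamma> = "\<lambda>k. step_size ell (norm (g (x k)))"
  have "(F (x (Suc T)) - F y) * (\<Sum>k<T. ?\<gamma> k) \<le> (F (x T) - F y) * (\<Sum>k<T. ?\<gamma> k)"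
    using value_antimono[of T "Suc T"] by (intro mult_right_mono sum_nonneg step_size_nonneg) auto
  moreover have "?\<gamma> T * (F (x (Suc T)) - F y)
      \<le> ((norm (x T - y))\<^sup>2 - (norm (x (Suc T) - y))\<^sup>2) / 2"
    using distance_decrease[OF iterate_in_X y] by (simp add: iteration)
  moreover have "(F (x (Suc T)) - F y) * (\<Sum>k<Suc T. ?\<gamma> k)
      = (F (x (Suc T)) - F y) * (\<Sum>k<T. ?\<gamma> k) + ?\<gamma> T * (F (x (Suc T)) - F y)"
    by (simp add: algebra_simps)
  ultimately show ?case using Suc by argo
qed simp

text \<open>
  Each of the first \<open>n\<close> steps lowers the value by at least \<open>M\<^sup>2 / (2 * ell (2 * norm (g (x 0))))\<close>.
\<close>

lemma large_gradient_count:
  assumes "0 \<le> M" and "\<And>k. k < n \<Longrightarrow> M \<le> norm (g (x k))"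
  shows "real n * M\<^sup>2 \<le> 2 * ell (2 * norm (g (x 0))) * (F (x 0) - F y)"
proof -
  let ?l = "ell (2 * norm (g (x 0)))"
  have l: "0 < ?l" by (simp add: ell_pos)
  have "real n * M\<^sup>2 / (2 * ?l) \<le> F (x 0) - F (x n)"
    using assms(2)
  proof (induction n)
    case (Suc n)
    have "1 / ?l \<le> step_size ell (norm (g (x n)))"
      using gradient_norm_antimono[of 0 n] by (intro step_size_lower) auto
    moreover have "M\<^sup>2 \<le> (norm (g (x n)))\<^sup>2"
      using Suc.prems[of n] assms(1) by (intro power_mono) auto
    ultimately have "(1 / ?l / 2) * M\<^sup>2 \<le> step_size ell (norm (g (x n))) / 2 * (norm (g (x n)))\<^sup>2"
      using step_size_nonneg[of n] by (intro mult_mono divide_right_mono) auto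
    with value_decreasing[of n] Suc.IH[OF Suc.prems]
    show ?case by (simp add: distrib_right add_divide_distrib)
  qed simp
  also have "\<dots> \<le> F (x 0) - F y" using minimal[OF iterate_in_X] by simp
  finally show ?thesis using l by (simp add: field_simps)
qed

text \<open>
  Gradient norms do not increase, so the steps with a gradient norm above \<open>M\<close> form an initial
  segment, whose length is at most \<open>N\<close>; each later step is at least \<open>1 / ell (2 * M)\<close>.
\<close>

lemma total_step_lower:
  assumes M: "0 < M"
  defines "N \<equiv> 2 * ell (2 * norm (g (x 0))) * (F (x 0) - F y) / M\<^sup>2"
  shows "(real T - N) / ell (2 * M) \<le> (\<Sum>k<T. step_size ell (norm (g (x k))))"
proof (cases "real T \<le> N")
  case True
  have "(real T - N) / ell (2 * M) \<le> 0"
    using True M ell_pos[of "2 * M"] by (intro divide_nonpos_pos) auto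
  also have "0 \<le> (\<Sum>k<T. step_size ell (norm (g (x k))))"
    by (intro sum_nonneg step_size_nonneg)
  finally show ?thesis .
next
  case False
  have N0: "0 \<le> N"
    using minimal[OF start] ell_pos[of "2 * norm (g (x 0))"] by (simp add: N_def)
  define n where "n = nat \<lfloor>N\<rfloor>"
  have n: "real n \<le> N" "N < real n + 1"
    using N0 by (auto simp: n_def)
  have small: "norm (g (x n)) \<le> M"
  proof (rule ccontr)
    assume "\<not> norm (g (x n)) \<le> M"
    then have "M \<le> norm (g (x k))" if "k < Suc n" for k
      using gradient_norm_antimono[of k n] that by simp
    then have "real (Suc n) * M\<^sup>2 \<le> 2 * ell (2 * norm (g (x 0))) * (F (x 0) - F y)"
      using M by (intro large_gradient_count) auto
    then have "real (Suc n) \<le> N"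
      using M by (simp add: N_def field_simps)
    with n show False by simp
  qed
  have "n \<le> T" using False n by linarith
  have "(real T - N) / ell (2 * M) \<le> (real T - real n) / ell (2 * M)"
    using n M ell_pos[of "2 * M"] by (intro divide_right_mono) auto
  also have "\<dots> = (\<Sum>k\<in>{n..<T}. 1 / ell (2 * M))"
    using \<open>n \<le> T\<close> by (simp add: of_nat_diff)
  also have "\<dots> \<le> (\<Sum>k\<in>{n..<T}. step_size ell (norm (g (x k))))"
  proof (rule sum_mono)
    fix k assume "k \<in> {n..<T}"
    then have "norm (g (x k)) \<le> M"
      using gradient_norm_antimono[of n k] small by simp
    then show "1 / ell (2 * M) \<le> step_size ell (norm (g (x k)))"
      by (intro step_size_lower) auto
  qed
  also have "\<dots> \<le> (\<Sum>k<T. step_size ell (norm (g (x k))))"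
    by (intro sum_mono2 step_size_nonneg) auto
  finally show ?thesis .
qed

lemma convergence:
  assumes M: "0 < M" "ell (2 * M) \<le> 2 * ell 0" and "0 < \<epsilon>"
  defines "R \<equiv> norm (x 0 - y)"
    and "N \<equiv> 2 * ell (2 * norm (g (x 0))) * (F (x 0) - F y) / M\<^sup>2"
  assumes T: "ell 0 * R\<^sup>2 / \<epsilon> + min N (ell (2 * norm (g (x 0))) * R\<^sup>2 / (2 * \<epsilon>)) \<le> real T"
  shows "F (x T) - F y \<le> \<epsilon>"
proof (cases "R = 0")
  \<comment> \<open>For \<open>R = 0\<close> even \<open>T = 0\<close> is admitted, and the total step size may vanish.\<close>
  case True
  then have "x 0 = y" by (simp add: R_def)
  then show ?thesis using value_antimono[of 0 T] \<open>0 < \<epsilon>\<close> by simp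
next
  case False
  let ?\<Gamma> = "\<Sum>k<T. step_size ell (norm (g (x k)))"
  let ?l = "ell (2 * norm (g (x 0)))"
  have l: "0 < ?l" by (simp add: ell_pos)
  have "R\<^sup>2 / (2 * \<epsilon>) \<le> ?\<Gamma>"
  proof (cases "N \<le> ?l * R\<^sup>2 / (2 * \<epsilon>)")
    case True
    have l0: "0 < ell 0" "0 < ell (2 * M)" using M by (auto intro!: ell_pos)
    have "R\<^sup>2 / (2 * \<epsilon>) = (ell 0 * R\<^sup>2 / \<epsilon>) / (2 * ell 0)"
      using l0 by simp
    also have "\<dots> \<le> (ell 0 * R\<^sup>2 / \<epsilon>) / ell (2 * M)"
      using M l0 \<open>0 < \<epsilon>\<close> by (intro divide_left_mono) auto
    also have "\<dots> \<le> (real T - N) / ell (2 * M)"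
      using T True l0 by (intro divide_right_mono) auto
    also have "\<dots> \<le> ?\<Gamma>"
      unfolding N_def by (rule total_step_lower[OF M(1)])
    finally show ?thesis .
  next
    case False
    have "0 \<le> ell 0 * R\<^sup>2 / \<epsilon>" using ell_pos[of 0] \<open>0 < \<epsilon>\<close> by simp
    with False T have "?l * R\<^sup>2 / (2 * \<epsilon>) \<le> real T" by simp
    then have "R\<^sup>2 / (2 * \<epsilon>) \<le> real T * (1 / ?l)"
      using l by (simp add: field_simps)
    also have "\<dots> = (\<Sum>k<T. 1 / ?l)" by simp
    also have "\<dots> \<le> ?\<Gamma>"
      using gradient_norm_antimono[of 0] by (intro sum_mono step_size_lower) auto
    finally show ?thesis .
  qed
  moreover have "0 \<le> F (x T) - F y" using minimal[OF iterate_in_X] by simp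
  ultimately have "(F (x T) - F y) * (R\<^sup>2 / (2 * \<epsilon>)) \<le> (F (x T) - F y) * ?\<Gamma>"
    by (intro mult_left_mono)
  also have "\<dots> \<le> R\<^sup>2 / 2"
    unfolding R_def by (rule order_trans[OF value_gap_times_total_step]) simp
  also have "\<dots> = \<epsilon> * (R\<^sup>2 / (2 * \<epsilon>))"
    using \<open>0 < \<epsilon>\<close> by simp
  finally show ?thesis
    by (rule mult_right_le_imp_le) (use False \<open>0 < \<epsilon>\<close> in simp)
qed

end

section \<open>Extended-real-valued functions on Euclidean space\<close>

text \<open>
  The ambient space of all finitely supported sequences is infinite-dimensional, so \<open>\<real>\<^sup>d\<close> is exhibited as an
  intersection of kernels of coordinate functionals.
\<close>

lemma closed_Rn: "closed (Rn d)"
proof -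
  have "Rn d = (\<Inter>i\<in>{d..}. {z. inner (Poly_Mapping.single i 1) z = 0})"
    by (auto simp: Rn_def inner_poly_mapping_def)
  moreover have "closed \<dots>"
    by (intro closed_INT ballI closed_Collect_eq continuous_intros)
  ultimately show ?thesis by simp
qed

text \<open>
  A sublevel set of the finite part of \<open>f\<close> is closed because \<open>f\<close> is continuous on the closure of the
  effective domain and takes the value \<open>\<infinity>\<close> on the part of this closure outside the domain.  The
  spectral norm controls \<open>H v\<close> because a derivative is a bounded operator, which makes the set of reals
  in the definition of the spectral norm bounded above.
\<close>

lemma (in growth_bound) ell_smooth_convex_imp_locale:
  assumes f: "ell_smooth ell d f" and conv: "convex_fun d f"
  obtains H where "convex_generalized_smooth ell (Rn d) (effective_domain d f)
    (\<lambda>z. real_of_ereal (f z)) (gradient d f) H"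
proof -
  let ?X = "effective_domain d f"
  let ?F = "\<lambda>z. real_of_ereal (f z)"
  have X_sub: "z \<in> Rn d" if "z \<in> ?X" for z using that by (simp add: effective_domain_def)
  have fin: "f z = ereal (?F z)" if "z \<in> ?X" for z
    using that f by (auto simp: effective_domain_def ell_smooth_def ereal_real)
  have grad: "has_gradient d f (gradient d f z) z" if "z \<in> ?X" for z
    using f that gradient_eqI[OF _ X_sub[OF that]] unfolding ell_smooth_def by metis
  define H where "H z = (SOME H. has_hessian d f H z \<and> spectral_norm d H \<le> ell (norm (gradient d f z)))" for z
  have H: "has_hessian d f (H z) z" "spectral_norm d (H z) \<le> ell (norm (gradient d f z))"
    if "z \<in> ?X" for z
    using someI_ex[of "\<lambda>H. has_hessian d f H z \<and> spectral_norm d H \<le> ell (norm (gradient d f z))"]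
      f that unfolding ell_smooth_def H_def by blast+
  have "convex_generalized_smooth ell (Rn d) ?X ?F (gradient d f) H"
  proof unfold_locales
    show "subspace (Rn d)" by (rule subspace_Rn)
    show "openin (top_of_set (Rn d)) ?X" using f by (simp add: ell_smooth_def)
    show "closed {z \<in> ?X. ?F z \<le> \<alpha>}" for \<alpha>
    proof -
      have "closure ?X \<subseteq> Rn d"
        using X_sub closed_Rn by (intro closure_minimal) auto
      then have "{z \<in> ?X. ?F z \<le> \<alpha>} = closure ?X \<inter> f -` {..ereal \<alpha>}"
      proof (intro set_eqI iffI)
        fix z assume "z \<in> {z \<in> ?X. ?F z \<le> \<alpha>}"
        then have z: "z \<in> ?X" "?F z \<le> \<alpha>" by auto
        have "f z \<le> ereal \<alpha>" by (subst fin[OF z(1)]) (simp add: z(2))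
        with z(1) show "z \<in> closure ?X \<inter> f -` {..ereal \<alpha>}"
          using closure_subset[of ?X] by auto
      next
        fix z assume z: "z \<in> closure ?X \<inter> f -` {..ereal \<alpha>}"
        then have "f z < \<infinity>" by (cases "f z") auto
        with z \<open>closure ?X \<subseteq> Rn d\<close> have zX: "z \<in> ?X" by (auto simp: effective_domain_def)
        have "ereal (?F z) \<le> ereal \<alpha>" by (subst fin[OF zX, symmetric]) (use z in simp)
        with zX show "z \<in> {z \<in> ?X. ?F z \<le> \<alpha>}" by simp
      qed
      moreover have "closed (closure ?X \<inter> f -` {..ereal \<alpha>})"
        using f by (intro continuous_closed_preimage) (auto simp: ell_smooth_def)
      ultimately show ?thesis by simp
    qed
    fix z assume z: "z \<in> ?X"
    show "(?F has_derivative inner (gradient d f z)) (at z within Rn d)" "gradient d f z \<in> Rn d"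
      using grad[OF z] by (auto simp: has_gradient_def)
    show Hz: "(gradient d f has_derivative H z) (at z within Rn d)"
      using H(1)[OF z] by (simp add: has_hessian_def)
    fix v assume v: "v \<in> Rn d"
    interpret Hz: bounded_linear "H z" using Hz by (rule has_derivative_bounded_linear)
    have "norm (H z v) \<le> spectral_norm d (H z) * norm v"
    proof (cases "v = 0")
      case False
      have "bdd_above ((\<lambda>v. norm (H z v)) ` {v \<in> Rn d. norm v \<le> 1})"
      proof -
        obtain K where K: "0 < K" "\<And>v. norm (H z v) \<le> norm v * K"
          using Hz.pos_bounded by blast
        have "norm (H z v) \<le> K" if "norm v \<le> 1" for v
        proof -
          have "norm v * K \<le> 1 * K"
            using that K(1) by (intro mult_right_mono) auto
          with K(2)[of v] show ?thesis by linarith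
        qed
        then show ?thesis by (auto intro!: bdd_aboveI[of _ K])
      qed
      then have "norm (H z ((1 / norm v) *\<^sub>R v)) \<le> spectral_norm d (H z)"
        unfolding spectral_norm_def
        using v by (intro cSUP_upper) (auto intro!: subspace_scale[OF subspace_Rn])
      then show ?thesis
        using False by (simp add: Hz.scaleR field_simps)
    qed (simp add: Hz.zero)
    also have "\<dots> \<le> ell (norm (gradient d f z)) * norm v"
      using H(2)[OF z] by (intro mult_right_mono) auto
    finally show "norm (H z v) \<le> ell (norm (gradient d f z)) * norm v" .
  next
    show "convex_on ?X ?F"
      unfolding convex_on_def
    proof (intro conjI ballI allI impI)
      show "convex ?X" using f by (simp add: ell_smooth_def)
      fix a b u v assume ab: "a \<in> ?X" "b \<in> ?X" and uv: "0 \<le> u" "0 \<le> v" "u + v = (1::real)"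
      have "u *\<^sub>R a + v *\<^sub>R b \<in> ?X"
        using \<open>convex ?X\<close> ab uv by (auto simp: convex_def)
      then have "ereal (?F (u *\<^sub>R a + v *\<^sub>R b)) \<le> ereal u * ereal (?F a) + ereal v * ereal (?F b)"
        using conv ab uv X_sub fin unfolding convex_fun_def by metis
      then show "?F (u *\<^sub>R a + v *\<^sub>R b) \<le> u * ?F a + v * ?F b" by simp
    qed
  qed
  then show ?thesis by (rule that)
qed

lemma locally_lipschitz_nonneg_imp_continuous_on:
  assumes "locally_lipschitz_nonneg ell"
  shows "continuous_on {0..} ell"
  unfolding continuous_on_eq_continuous_within
proof
  fix s :: real assume s: "s \<in> {0..}"
  then obtain u L where u: "0 < u" "L-lipschitz_on (cball s u \<inter> {0..}) ell"
    using assms by (auto simp: locally_lipschitz_nonneg_def)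
  then have "continuous (at s within cball s u \<inter> {0..}) ell"
    using lipschitz_on_continuous_on[OF u(2)] s by (simp add: continuous_on_eq_continuous_within)
  moreover have "at s within cball s u \<inter> {0..} = at s within {0..}"
    by (rule at_within_nhd[of s "ball s u"]) (use u in auto)
  ultimately show "continuous (at s within {0..}) ell" by (simp add: continuous_within)
qed

theorem corollary8p5:
  fixes ell :: "real \<Rightarrow> real"
  assumes "\<And>s. 0 \<le> s \<Longrightarrow> 0 < ell s"
    and "mono_on {0..} ell"
    and "locally_lipschitz_nonneg ell"
  shows "\<forall>\<Delta>\<ge>0. \<forall>M0\<ge>0. \<exists>Tbar::real. Tbar \<ge> 0 \<and>
    (\<forall>(d::nat) (f :: fseq \<Rightarrow> ereal) (xmin :: fseq) (x :: nat \<Rightarrow> fseq).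
      ell_smooth ell d f \<longrightarrow> convex_fun d f \<longrightarrow> is_minimizer d f xmin \<longrightarrow>
      x 0 \<in> effective_domain d f \<longrightarrow>
      f (x 0) - f xmin = ereal \<Delta> \<longrightarrow>
      norm (gradient d f (x 0)) = M0 \<longrightarrow>
      gradient_descent ell d f x \<longrightarrow>
      (let R = norm (x 0 - xmin) in
       \<forall>\<epsilon>>0. \<forall>T::nat.
         real T \<ge> ell 0 * R\<^sup>2 / \<epsilon> + min Tbar (ell (2 * M0) * R\<^sup>2 / (2 * \<epsilon>)) \<longrightarrow>
         f (x T) - f xmin \<le> ereal \<epsilon>))"
proof -
  interpret growth_bound ell
    by unfold_locales (fact assms(1), fact assms(2),
        rule locally_lipschitz_nonneg_imp_continuous_on[OF assms(3)])
  obtain M where M: "0 < M" "ell (2 * M) \<le> 2 * ell 0"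
  proof -
    have "(ell \<longlongrightarrow> ell 0) (at 0 within {0..})"
      using ell_cont by (simp add: continuous_on)
    then have "\<forall>\<^sub>F s in at 0 within {0..}. ell s < 2 * ell 0"
      using ell_pos[of 0] by (intro order_tendstoD) auto
    then obtain r where r: "0 < r" "\<And>s. s \<in> {0..} \<Longrightarrow> s \<noteq> 0 \<Longrightarrow> dist s 0 < r \<Longrightarrow> ell s < 2 * ell 0"
      unfolding eventually_at by metis
    show ?thesis
      by (rule that[of "r / 4"]) (use r(1) r(2)[of "2 * (r / 4)"] in auto)
  qed
  show ?thesis
    unfolding Let_def
  proof (intro allI impI)
    fix \<Delta> M0 :: real assume \<Delta>: "0 \<le> \<Delta>" and M0: "0 \<le> M0"
    define Tbar where "Tbar = 2 * ell (2 * M0) * \<Delta> / M\<^sup>2"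
    show "\<exists>Tbar::real. Tbar \<ge> 0 \<and>
      (\<forall>(d::nat) (f :: fseq \<Rightarrow> ereal) (xmin :: fseq) (x :: nat \<Rightarrow> fseq).
        ell_smooth ell d f \<longrightarrow> convex_fun d f \<longrightarrow> is_minimizer d f xmin \<longrightarrow>
        x 0 \<in> effective_domain d f \<longrightarrow>
        f (x 0) - f xmin = ereal \<Delta> \<longrightarrow>
        norm (gradient d f (x 0)) = M0 \<longrightarrow>
        gradient_descent ell d f x \<longrightarrow>
        (\<forall>\<epsilon>>0. \<forall>T::nat.
           real T \<ge> ell 0 * (norm (x 0 - xmin))\<^sup>2 / \<epsilon> +
             min Tbar (ell (2 * M0) * (norm (x 0 - xmin))\<^sup>2 / (2 * \<epsilon>)) \<longrightarrow>
           f (x T) - f xmin \<le> ereal \<epsilon>))"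
    proof (rule exI[of _ Tbar], intro conjI allI impI)
      show "0 \<le> Tbar"
        using \<Delta> M0 ell_pos[of "2 * M0"] by (simp add: Tbar_def)
    next
      fix d f xmin and x :: "nat \<Rightarrow> fseq" and \<epsilon> :: real and T :: nat
      assume f: "ell_smooth ell d f" "convex_fun d f" and xmin: "is_minimizer d f xmin"
        and x: "x 0 \<in> effective_domain d f" "f (x 0) - f xmin = ereal \<Delta>"
          "norm (gradient d f (x 0)) = M0" "gradient_descent ell d f x"
        and \<epsilon>: "0 < \<epsilon>"
        and T: "real T \<ge> ell 0 * (norm (x 0 - xmin))\<^sup>2 / \<epsilon> +
          min Tbar (ell (2 * M0) * (norm (x 0 - xmin))\<^sup>2 / (2 * \<epsilon>))"
      let ?F = "\<lambda>z. real_of_ereal (f z)"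
      obtain H where "convex_generalized_smooth ell (Rn d) (effective_domain d f)
          ?F (gradient d f) H"
        by (rule ell_smooth_convex_imp_locale[OF f])
      then interpret convex_generalized_smooth ell "Rn d" "effective_domain d f"
        ?F "gradient d f" H .
      have fin: "f z = ereal (?F z)" if "z \<in> effective_domain d f" for z
        using that f(1) by (auto simp: effective_domain_def ell_smooth_def ereal_real)
      have "f xmin \<le> f (x 0)"
        using xmin X_sub[OF x(1)] by (simp add: is_minimizer_def)
      then have xminX: "xmin \<in> effective_domain d f"
        using xmin x(1) by (auto simp: is_minimizer_def effective_domain_def)
      interpret convex_gradient_descent ell "Rn d" "effective_domain d f"
        ?F "gradient d f" H x xmin
      proof unfold_locales
        show "x 0 \<in> effective_domain d f" "xmin \<in> effective_domain d f" by fact+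
        show "x (Suc k) = x k - step_size ell (norm (gradient d f (x k))) *\<^sub>R gradient d f (x k)" for k
          using x(4) by (simp add: gradient_descent_def)
        show "?F xmin \<le> ?F z" if "z \<in> effective_domain d f" for z
        proof -
          have "f xmin \<le> f z" using xmin X_sub[OF that] by (simp add: is_minimizer_def)
          then have "ereal (?F xmin) \<le> ereal (?F z)"
            unfolding fin[OF that, symmetric] fin[OF xminX, symmetric] .
          then show ?thesis by simp
        qed
      qed
      have diff: "f z - f xmin = ereal (?F z - ?F xmin)" if "z \<in> effective_domain d f" for z
        by (subst (1) fin[OF that], subst (1) fin[OF xminX]) (rule ereal_minus(1))
      have "?F (x 0) - ?F xmin = \<Delta>"
        using x(2) unfolding diff[OF x(1)] by simp
      then have "?F (x T) - ?F xmin \<le> \<epsilon>"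
        using T x(3) by (intro convergence[OF M \<epsilon>]) (simp add: Tbar_def)
      then show "f (x T) - f xmin \<le> ereal \<epsilon>"
        unfolding diff[OF iterate_in_X] by simp
    qed
  qed
qed

end
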